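(* Let $d,s\ge 1$ be integers. For every $f\in\mathcal{F}^{d,s}_{\infty-\text{ST}}$, we have $$\frac{1}{\min(2^s-1,2^d)}\cdot\Big(\sup_{\mathbf{a}\in\{-\infty,+\infty\}^d}\mathrm{HK}_{\mathbf{a}}(f)\Big)\le V^{d,s}_{\infty-\text{XGB}}(f)\le\inf_{\mathbf{a}\in\{-\infty,+\infty\}^d}\mathrm{HK}_{\mathbf{a}}(f).$$ Both sides of the inequality are tight, in the sense that there exist non-constant functions in $\mathcal{F}^{d,s}_{\infty-\text{ST}}$ for which the left and right inequalities hold with equality, respectively.
   Context: Notation: $[d]=\{1,\dots,d\}$. Function class. For (not necessarily disjoint) $L,U\subseteq[d]$ with $0<|L|+|U|\le s$ and $\mathbf{l}=(l_j,j\in L)$, $\mathbf{u}=(u_j,j\in U)$ real vectors, let $b^{L,U}_{\mathbf{l},\mathbf{u}}(x_1,\dots,x_d)=\prod_{j\in L}\mathbf{1}(x_j\ge l_j)\cdot\prod_{j\in U}\mathbf{1}(x_j<u_j)$. For $c\in\mathbb{R}$ and finite signed Borel measures $\nu_{L,U}$ on $\mathbb{R}^{|L|+|U|}$, let $f^{d,s}_{c,\{\nu_{L,U}\}}(\mathbf{x})=c+\sum_{0<|L|+|U|\le s}\int_{\mathbb{R}^{|L|+|U|}}b^{L,U}_{\mathbf{l},\mathbf{u}}(\mathbf{x})\,d\nu_{L,U}(\mathbf{l},\mathbf{u})$. $\mathcal{F}^{d,s}_{\infty-\text{ST}}$ is the set of all such functions, and $V^{d,s}_{\infty-\text{XGB}}(f)=\inf\{\sum_{0<|L|+|U|\le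 s}\|\nu_{L,U}\|_{\text{TV}}: f^{d,s}_{c,\{\nu_{L,U}\}}\equiv f\}$, with $\|\nu\|_{\text{TV}}=|\nu|(\mathbb{R}^{|L|+|U|})$. Vitali variation. For $g:\mathbb{R}^m\to\mathbb{R}$ and $u_j<v_j$, the quasi-volume is $\Delta(g;\prod_{j=1}^m[u_j,v_j])=\sum_{\boldsymbol{\delta}\in\{0,1\}^m}(-1)^{\delta_1+\cdots+\delta_m}g((1-\delta_1)v_1+\delta_1u_1,\dots,(1-\delta_m)v_m+\delta_mu_m)$. An axis-aligned split of $\prod_{j=1}^m[a_j,b_j]$ ($a_j<b_j$ real) is the collection of all rectangles $\prod_{j=1}^m[u^{(j)}_{l_j},u^{(j)}_{l_j+1}]$, $l_j\in[n_j]$, obtained from partitions $a_j=u^{(j)}_1<\cdots<u^{(j)}_{n_j+1}=b_j$. $\mathrm{Vit}(g;\prod_j[a_j,b_j])=\sup_{\mathcal{P}}\sum_{R\in\mathcal{P}}|\Delta(g;R)|$ over all axis-aligned splits $\mathcal{P}$, and $\mathrm{Vit}(g)$ is the supremum of $\mathrm{Vit}(g;\prod_j[a_j,b_j])$ over all rectangles in $\mathbb{R}^m$. HK variation. For $\mathbf{a}\in\{-\infty,+\infty\}^d$, $S\subseteq[d]$, $S^c=[d]\setminus S$, let $f^S_{(a_j,j\in S^c)}(x_j,j\in S)=\lim_{(x_j,j\in S^c)\to(a_j,j\in S^c)}f(x_1,\dots,x_d)$ (these limits exist and are finite for all $f\in\mathcal{F}^{d,s}_{\infty-\text{ST}}$).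 The Hardy–Krause variation anchored at $\mathbf{a}$ is $\mathrm{HK}_{\mathbf{a}}(f)=\sum_{\emptyset\ne S\subseteq[d]}\mathrm{Vit}(f^S_{(a_j,j\in S^c)})$. *)

theory Defs
  imports "HOL-Analysis.Analysis"
begin

text \<open>
  Vectors with coordinates in a finite set \<open>I\<close> of natural numbers are the functions in
  \<^term>\<open>PiE I (\<lambda>_. UNIV :: real set)\<close>, so \<open>\<real>\<^sup>d\<close> is the case \<^term>\<open>I = {1..d}\<close>.  A real function of
  such vectors has type \<open>(nat \<Rightarrow> real) \<Rightarrow> real\<close>; only its values on this carrier matter.
\<close>

abbreviation vecs :: "nat set \<Rightarrow> (nat \<Rightarrow> real) set" where
  "vecs I \<equiv> PiE I (\<lambda>_. UNIV)"

text \<open>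
  Only the sigma-algebra of \<open>M\<close> is used.  Finiteness is automatic, as the values are real numbers.
\<close>

definition signed_measure :: "'a measure \<Rightarrow> ('a set \<Rightarrow> real) \<Rightarrow> bool" where
  "signed_measure M \<nu> \<longleftrightarrow> \<nu> {} = 0 \<and>
     (\<forall>A. range A \<subseteq> sets M \<longrightarrow> disjoint_family A \<longrightarrow>
        (\<lambda>i. \<nu> (A i)) sums \<nu> (\<Union>i::nat. A i))"

text \<open>
  Jordan decomposition: \<open>\<nu>\<^sup>+(A) = sup {\<nu>(B) | B \<subseteq> A measurable}\<close> and \<open>\<nu>\<^sup>- = (-\<nu>)\<^sup>+\<close>.
  Negative values \<open>\<nu>(B)\<close> are truncated to \<open>0\<close> by \<^term>\<open>ennreal\<close>; this does not affect the
  supremum because \<open>B = {}\<close> contributes \<open>0\<close>.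
\<close>

definition upper_variation :: "'a measure \<Rightarrow> ('a set \<Rightarrow> real) \<Rightarrow> 'a set \<Rightarrow> ennreal" where
  "upper_variation M \<nu> A = (SUP B\<in>{B \<in> sets M. B \<subseteq> A}. ennreal (\<nu> B))"

definition pos_part :: "'a measure \<Rightarrow> ('a set \<Rightarrow> real) \<Rightarrow> 'a measure" where
  "pos_part M \<nu> = measure_of (space M) (sets M) (upper_variation M \<nu>)"

definition neg_part :: "'a measure \<Rightarrow> ('a set \<Rightarrow> real) \<Rightarrow> 'a measure" where
  "neg_part M \<nu> = pos_part M (\<lambda>A. - \<nu> A)"

definition tv_norm :: "'a measure \<Rightarrow> ('a set \<Rightarrow> real) \<Rightarrow> ennreal" where
  "tv_norm M \<nu> = emeasure (pos_part M \<nu>) (space M) + emeasure (neg_part M \<nu>) (space M)"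

definition signed_integral :: "'a measure \<Rightarrow> ('a set \<Rightarrow> real) \<Rightarrow> ('a \<Rightarrow> real) \<Rightarrow> real" where
  "signed_integral M \<nu> h = integral\<^sup>L (pos_part M \<nu>) h - integral\<^sup>L (neg_part M \<nu>) h"

definition index_pairs :: "nat \<Rightarrow> nat \<Rightarrow> (nat set \<times> nat set) set" where
  "index_pairs d s =
     {(L, U). L \<subseteq> {1..d} \<and> U \<subseteq> {1..d} \<and> 0 < card L + card U \<and> card L + card U \<le> s}"

definition basis_fun ::
    "nat set \<Rightarrow> nat set \<Rightarrow> (nat \<Rightarrow> real) \<Rightarrow> (nat \<Rightarrow> real) \<Rightarrow> (nat \<Rightarrow> real) \<Rightarrow> real" where
  "basis_fun L U l u x = (\<Prod>j\<in>L. of_bool (x j \<ge> l j)) * (\<Prod>j\<in>U. of_bool (x j < u j))"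

text \<open>
  The parameter space \<open>\<real>\<^bsup>|L|+|U|\<^esup>\<close> is represented as \<open>\<real>\<^bsup>L\<^esup> \<times> \<real>\<^bsup>U\<^esup>\<close>, whose Borel
  sigma-algebra is the product sigma-algebra.  \<open>L\<close> and \<open>U\<close> may overlap, so the two
  factors have to be kept apart.
\<close>

definition param_space ::
    "nat set \<times> nat set \<Rightarrow> ((nat \<Rightarrow> real) \<times> (nat \<Rightarrow> real)) measure" where
  "param_space = (\<lambda>(L, U). PiM L (\<lambda>_. borel) \<Otimes>\<^sub>M PiM U (\<lambda>_. borel))"

type_synonym signed_family =
  "nat set \<times> nat set \<Rightarrow> ((nat \<Rightarrow> real) \<times> (nat \<Rightarrow> real)) set \<Rightarrow> real"

definition st_fun ::
    "nat \<Rightarrow> nat \<Rightarrow> real \<Rightarrow> signed_family \<Rightarrow> (nat \<Rightarrow> real) \<Rightarrow> real" where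
  "st_fun d s c \<nu> x = c + (\<Sum>(L, U)\<in>index_pairs d s.
     signed_integral (param_space (L, U)) (\<nu> (L, U)) (\<lambda>(l, u). basis_fun L U l u x))"

definition represents ::
    "nat \<Rightarrow> nat \<Rightarrow> real \<Rightarrow> signed_family \<Rightarrow> ((nat \<Rightarrow> real) \<Rightarrow> real) \<Rightarrow> bool" where
  "represents d s c \<nu> f \<longleftrightarrow>
     (\<forall>p\<in>index_pairs d s. signed_measure (param_space p) (\<nu> p)) \<and>
     (\<forall>x\<in>vecs {1..d}. st_fun d s c \<nu> x = f x)"

definition F_ST :: "nat \<Rightarrow> nat \<Rightarrow> ((nat \<Rightarrow> real) \<Rightarrow> real) set" where
  "F_ST d s = {f. \<exists>c \<nu>. represents d s c \<nu> f}"

definition V_XGB :: "nat \<Rightarrow> nat \<Rightarrow> ((nat \<Rightarrow> real) \<Rightarrow> real) \<Rightarrow> ennreal" where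
  "V_XGB d s f = (INF (c, \<nu>)\<in>{(c, \<nu>). represents d s c \<nu> f}.
     \<Sum>p\<in>index_pairs d s. tv_norm (param_space p) (\<nu> p))"

text \<open>
  A rectangle \<open>\<Prod>\<^sub>j [u\<^sub>j, v\<^sub>j]\<close>, with \<open>j\<close> ranging over \<open>S\<close>, is given by the pair \<open>(u, v)\<close> of its
  corners in \<^term>\<open>vecs S\<close>.
\<close>

definition quasi_volume ::
    "nat set \<Rightarrow> ((nat \<Rightarrow> real) \<Rightarrow> real) \<Rightarrow> (nat \<Rightarrow> real) \<times> (nat \<Rightarrow> real) \<Rightarrow> real" where
  "quasi_volume S g = (\<lambda>(u, v). \<Sum>\<delta>\<in>PiE S (\<lambda>_. {0, 1 :: nat}).
     (- 1) ^ (\<Sum>j\<in>S. \<delta> j) * g (\<lambda>j\<in>S. (1 - real (\<delta> j)) * v j + real (\<delta> j) * u j))"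

definition axis_aligned_splits ::
    "nat set \<Rightarrow> (nat \<Rightarrow> real) \<Rightarrow> (nat \<Rightarrow> real) \<Rightarrow> ((nat \<Rightarrow> real) \<times> (nat \<Rightarrow> real)) set set" where
  "axis_aligned_splits S a b =
     {(\<lambda>l. (\<lambda>j\<in>S. u j (l j), \<lambda>j\<in>S. u j (l j + 1))) ` PiE S (\<lambda>j. {1..n j}) |
        (n :: nat \<Rightarrow> nat) (u :: nat \<Rightarrow> nat \<Rightarrow> real).
        \<forall>j\<in>S. 1 \<le> n j \<and> u j 1 = a j \<and> u j (n j + 1) = b j \<and>
              (\<forall>k\<in>{1..n j}. u j k < u j (k + 1))}"

definition Vit_on ::
    "nat set \<Rightarrow> ((nat \<Rightarrow> real) \<Rightarrow> real) \<Rightarrow> (nat \<Rightarrow> real) \<Rightarrow> (nat \<Rightarrow> real) \<Rightarrow> ennreal" where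
  "Vit_on S g a b = (SUP P\<in>axis_aligned_splits S a b. \<Sum>R\<in>P. ennreal \<bar>quasi_volume S g R\<bar>)"

definition Vit :: "nat set \<Rightarrow> ((nat \<Rightarrow> real) \<Rightarrow> real) \<Rightarrow> ennreal" where
  "Vit S g = (SUP (a, b)\<in>{(a, b). a \<in> vecs S \<and> b \<in> vecs S \<and> (\<forall>j\<in>S. a j < b j)}. Vit_on S g a b)"

definition anchors :: "nat \<Rightarrow> (nat \<Rightarrow> ereal) set" where
  "anchors d = PiE {1..d} (\<lambda>_. {-\<infinity>, \<infinity>})"

text \<open>The filter of \<open>(y\<^sub>j, j \<in> T) \<rightarrow> (a\<^sub>j, j \<in> T)\<close>, jointly in all coordinates of \<open>T\<close>.\<close>

definition to_anchor :: "nat set \<Rightarrow> (nat \<Rightarrow> ereal) \<Rightarrow> (nat \<Rightarrow> real) filter" where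
  "to_anchor T a = (INF j\<in>T. filtercomap (\<lambda>y. y j) (if a j = \<infinity> then at_top else at_bot))"

text \<open>For \<^term>\<open>S = {1..d}\<close> the limit is that of a constant, so the section is \<open>f\<close> itself.\<close>

definition anchored_section ::
    "nat \<Rightarrow> nat set \<Rightarrow> (nat \<Rightarrow> ereal) \<Rightarrow> ((nat \<Rightarrow> real) \<Rightarrow> real) \<Rightarrow> (nat \<Rightarrow> real) \<Rightarrow> real" where
  "anchored_section d S a f x =
     Lim (to_anchor ({1..d} - S) a) (\<lambda>y. f (merge S ({1..d} - S) (x, y)))"

definition HK :: "nat \<Rightarrow> (nat \<Rightarrow> ereal) \<Rightarrow> ((nat \<Rightarrow> real) \<Rightarrow> real) \<Rightarrow> ennreal" where
  "HK d a f = (\<Sum>S\<in>Pow {1..d} - {{}}. Vit S (anchored_section d S a f))"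

end

theory Submission
  imports Defs "HOL-Probability.Distribution_Functions"
begin

text \<open>
  Fix an anchor \<open>a\<close>.  Writing \<open>1(x \<ge> l) = 1 - 1(x < l)\<close> and the like in every coordinate, each basis
  function becomes a signed sum of products of threshold indicators that vanish at \<open>a\<close>.  Hence
  \<open>f = c + (\<Sum>S. \<mu>\<^sub>S(orthant a S x))\<close> with signed measures \<open>\<mu>\<^sub>S\<close> on \<open>\<real>\<^bsup>S\<^esup>\<close> that are signed sums of push-forwards
  of the \<open>\<nu>\<^bsub>L,U\<^esub>\<close>.  The quasi-volume of the section of \<open>f\<close> along \<open>S\<close> over a rectangle is, up to sign, \<open>\<mu>\<^sub>S\<close>
  of the half-open rectangle, because the terms of the other \<open>\<mu>\<^sub>T\<close> cancel or vanish at \<open>a\<close>; so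
  \<open>HK\<^sub>a(f) = (\<Sum>S. \<parallel>\<mu>\<^sub>S\<parallel>)\<close>.  The upper bound on \<open>V\<close> follows since this representation is itself admissible,
  and the lower bound since a basis function expands into at most \<open>min (2\<^sup>s - 1) (2\<^sup>d)\<close> nonconstant terms.
  Equality on the left holds for the indicator of \<open>x\<^sub>1, \<dots>, x\<^sub>s \<ge> 0\<close> if \<open>s \<le> d\<close>, and for that of
  \<open>x\<^sub>1, \<dots>, x\<^sub>d \<ge> 0, x\<^sub>1 < 1\<close> otherwise; equality on the right holds for \<open>1(x\<^sub>1 \<ge> 0)\<close>.
\<close>

section \<open>Signed measures\<close>

text \<open>The constant is decided by coordinates lying in both L and U. Such a coordinate uses two
  of the s indices, but its factor 1(l <= x < u) is a difference of two thresholds without constant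
  term, so no term of the expansion is constant. A disjoint pair gives at most 2^|L \<union> U| - 1
  nonconstant terms with |L \<union> U| <= min(s, d), an overlapping one at most 2^|L \<union> U|
  with |L \<union> U| <= min(s - 1, d). The first count is the larger one for s <= d, the second for
  s > d, which explains both the minimum and the two extremal functions. The anchored indicators are
  1(x < w) at +infinity and 1(x >= w) at -infinity. Both belong to the original class, and for both
  the increment over [u, v] detects exactly the thresholds in (u, v]. The hard half of the formula
  for HK is that grids see the whole norm: the Vitali variation tests only axis-aligned splits, the
  norm all Borel sets. An almost optimal Borel set is therefore approximated, in the total variation
  measure, by a union of grid cells.\<close>

lemma signed_measure_empty: "signed_measure M \<nu> \<Longrightarrow> \<nu> {} = 0"
  by (simp add: signed_measure_def)

lemma signed_measure_sums:
  assumes "signed_measure M \<nu>" "range A \<subseteq> sets M" "disjoint_family A"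
  shows "(\<lambda>i. \<nu> (A i)) sums \<nu> (\<Union>i::nat. A i)"
  using assms by (simp add: signed_measure_def)

lemma signed_measure_Un:
  assumes "signed_measure M \<nu>" "A \<in> sets M" "B \<in> sets M" "A \<inter> B = {}"
  shows "\<nu> (A \<union> B) = \<nu> A + \<nu> B"
proof -
  have "(\<lambda>i. \<nu> (binaryset A B i)) sums \<nu> (\<Union>i. binaryset A B i)"
    using assms by (intro signed_measure_sums[of M])
      (auto simp: range_binaryset_eq disjoint_family_on_def binaryset_def)
  moreover have "(\<lambda>i. \<nu> (binaryset A B i)) sums (\<nu> A + \<nu> B)"
    using signed_measure_empty[OF assms(1)] by (rule binaryset_sums)
  ultimately show ?thesis
    by (metis UN_binaryset_eq sums_unique2)
qed

lemma signed_measure_Diff: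
  assumes "signed_measure M \<nu>" "A \<in> sets M" "B \<in> sets M" "B \<subseteq> A"
  shows "\<nu> (A - B) = \<nu> A - \<nu> B"
  using signed_measure_Un[OF assms(1), of B "A - B"] assms
  by (auto simp: Un_absorb1)

lemma signed_measure_uminus: "signed_measure M \<nu> \<Longrightarrow> signed_measure M (\<lambda>A. - \<nu> A)"
  by (auto simp: signed_measure_def sums_minus)

lemma signed_measure_zero: "signed_measure M (\<lambda>A. 0)"
  by (simp add: signed_measure_def)

lemma signed_measure_diff:
  "signed_measure M \<nu> \<Longrightarrow> signed_measure M \<mu> \<Longrightarrow> signed_measure M (\<lambda>A. \<nu> A - \<mu> A)"
  by (auto simp: signed_measure_def intro!: sums_diff)

lemma signed_measure_sum:
  assumes "\<And>i. i \<in> I \<Longrightarrow> signed_measure M (\<nu> i)"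
  shows "signed_measure M (\<lambda>A. \<Sum>i\<in>I. \<nu> i A)"
  using assms by (auto simp: signed_measure_def intro!: sums_sum)

lemma signed_measure_cmult: "signed_measure M \<nu> \<Longrightarrow> signed_measure M (\<lambda>A. c * \<nu> A)"
  by (auto simp: signed_measure_def intro!: sums_mult)

text \<open>Restriction to \<open>D\<close> is built into the push-forward because parameters with
  an empty interval l >= u have to be discarded before thresholds are read off.\<close>

lemma signed_measure_push:
  assumes "signed_measure M \<nu>" "\<phi> \<in> measurable M N" "D \<in> sets M"
  shows "signed_measure N (\<lambda>B. \<nu> (\<phi> -` B \<inter> D))"
  unfolding signed_measure_def
proof (intro conjI allI impI)
  show "\<nu> (\<phi> -` {} \<inter> D) = 0"
    using signed_measure_empty[OF assms(1)] by simp
next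
  fix A :: "nat \<Rightarrow> 'b set" assume A: "range A \<subseteq> sets N" "disjoint_family A"
  have "\<phi> -` A i \<inter> D \<in> sets M" for i
  proof -
    have "\<phi> -` A i \<inter> space M \<inter> D \<in> sets M"
      using A assms by (intro sets.Int measurable_sets[OF assms(2)]) auto
    then show ?thesis
      using sets.sets_into_space[OF assms(3)] by (simp add: Int_assoc inf.absorb2)
  qed
  then have "(\<lambda>i. \<nu> (\<phi> -` A i \<inter> D)) sums \<nu> (\<Union>i. \<phi> -` A i \<inter> D)"
    using A(2) by (intro signed_measure_sums[OF assms(1)]) (auto, use A(2) in \<open>fastforce simp: disjoint_family_on_def\<close>)
  then show "(\<lambda>i. \<nu> (\<phi> -` A i \<inter> D)) sums \<nu> (\<phi> -` (\<Union>i. A i) \<inter> D)"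
    by (simp add: vimage_UN)
qed

lemma signed_measure_dirac: "signed_measure M (\<lambda>B. indicator B z)"
  unfolding signed_measure_def
proof (intro conjI allI impI)
  fix A :: "nat \<Rightarrow> 'a set" assume dj: "disjoint_family A"
  show "(\<lambda>i. indicator (A i) z) sums (indicator (\<Union>i. A i) z :: real)"
  proof (cases "\<exists>i. z \<in> A i")
    case True
    then obtain i where i: "z \<in> A i" by blast
    then have "z \<notin> A j" if "j \<noteq> i" for j
      using dj that by (auto simp: disjoint_family_on_def)
    then have "(\<lambda>j. indicator (A j) z) = (\<lambda>j. if j = i then 1 else 0 :: real)"
      using i by (auto simp: indicator_def)
    then show ?thesis
      using i sums_single[of i "\<lambda>_. 1::real"] by (auto simp: indicator_def)
  next
    case False
    then show ?thesis by (simp add: indicator_def)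
  qed
qed simp

section \<open>Upper variation, boundedness and the Jordan decomposition\<close>

lemma upper_variation_ge: "B \<in> sets M \<Longrightarrow> B \<subseteq> A \<Longrightarrow> ennreal (\<nu> B) \<le> upper_variation M \<nu> A"
  unfolding upper_variation_def by (intro SUP_upper) auto

lemma upper_variation_le:
  "(\<And>B. B \<in> sets M \<Longrightarrow> B \<subseteq> A \<Longrightarrow> ennreal (\<nu> B) \<le> c) \<Longrightarrow> upper_variation M \<nu> A \<le> c"
  unfolding upper_variation_def by (intro SUP_least) auto

lemma upper_variation_mono: "A \<subseteq> A' \<Longrightarrow> upper_variation M \<nu> A \<le> upper_variation M \<nu> A'"
  by (rule upper_variation_le) (auto intro: upper_variation_ge)

text \<open>Competitors for \<open>A\<close> and \<open>B\<close> unite to a competitor for the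
  union. Since \<open>ennreal\<close> truncates, a competitor of negative value counts 0 and is
  dropped instead of being united.\<close>

lemma upper_variation_Un_ge:
  assumes "signed_measure M \<nu>" "A \<inter> B = {}"
  shows "upper_variation M \<nu> A + upper_variation M \<nu> B \<le> upper_variation M \<nu> (A \<union> B)"
proof -
  have *: "ennreal (\<nu> X) + ennreal (\<nu> Y) \<le> upper_variation M \<nu> (A \<union> B)"
    if X: "X \<in> sets M" "X \<subseteq> A" and Y: "Y \<in> sets M" "Y \<subseteq> B" for X Y
  proof -
    have "\<nu> (X \<union> Y) = \<nu> X + \<nu> Y"
      using X Y assms by (intro signed_measure_Un) auto
    then consider "\<nu> X \<ge> 0" "\<nu> Y \<ge> 0" "ennreal (\<nu> X) + ennreal (\<nu> Y) = ennreal (\<nu> (X \<union> Y))"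
      | "\<nu> X \<le> 0" | "\<nu> Y \<le> 0"
      by (metis ennreal_plus linear)
    then show ?thesis
    proof cases
      case 1
      have "ennreal (\<nu> (X \<union> Y)) \<le> upper_variation M \<nu> (A \<union> B)"
        using X Y by (intro upper_variation_ge) auto
      then show ?thesis using 1 by simp
    next
      case 2
      then show ?thesis using Y upper_variation_ge[of Y M "A \<union> B" \<nu>] by (auto simp: ennreal_neg)
    next
      case 3
      then show ?thesis using X upper_variation_ge[of X M "A \<union> B" \<nu>] by (auto simp: ennreal_neg)
    qed
  qed
  have ne: "{X \<in> sets M. X \<subseteq> C} \<noteq> {}" for C by auto
  have "upper_variation M \<nu> B + ennreal (\<nu> X) \<le> upper_variation M \<nu> (A \<union> B)"
    if X: "X \<in> sets M" "X \<subseteq> A" for X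
    unfolding upper_variation_def[of M \<nu> B] ennreal_SUP_add_left[symmetric, OF ne]
    using *[OF X] by (intro SUP_least) (simp add: add.commute)
  then show ?thesis
    unfolding upper_variation_def[of M \<nu> A] ennreal_SUP_add_left[symmetric, OF ne]
    by (intro SUP_least) (simp add: add.commute)
qed

lemma upper_variation_empty: "signed_measure M \<nu> \<Longrightarrow> upper_variation M \<nu> {} = 0"
  by (intro antisym upper_variation_le) (auto simp: signed_measure_empty)

text \<open>Superadditivity bounds the partial sums. Conversely, a subset \<open>B\<close> of the
  union is cut along the \<open>A i\<close>; the partial sums of
  \<open>\<nu> (B \<inter> A i)\<close> converge to \<open>\<nu> B\<close> and stay below the
  series.\<close>

lemma upper_variation_countably_additive:
  assumes "signed_measure M \<nu>"
  shows "countably_additive (sets M) (upper_variation M \<nu>)"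
  unfolding countably_additive_def
proof (intro allI impI antisym)
  fix A :: "nat \<Rightarrow> 'a set" assume A: "range A \<subseteq> sets M" "disjoint_family A"
  have fin: "(\<Sum>i<n. upper_variation M \<nu> (A i)) \<le> upper_variation M \<nu> (\<Union>i<n. A i)" for n
  proof (induction n)
    case 0
    then show ?case by simp
  next
    case (Suc n)
    have "A i \<inter> A n = {}" if "i < n" for i
      using A(2) that by (intro disjoint_family_onD[of A UNIV]) auto
    then have "(\<Union>i<n. A i) \<inter> A n = {}"
      by blast
    then have "upper_variation M \<nu> (\<Union>i<n. A i) + upper_variation M \<nu> (A n)
        \<le> upper_variation M \<nu> ((\<Union>i<n. A i) \<union> A n)"
      by (rule upper_variation_Un_ge[OF assms])
    from order_trans[OF add_right_mono[OF Suc.IH] this] show ?case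
      by (simp add: lessThan_Suc Un_commute add.commute)
  qed
  show "(\<Sum>i. upper_variation M \<nu> (A i)) \<le> upper_variation M \<nu> (\<Union>i. A i)"
  proof (rule suminf_le_const)
    show "(\<Sum>i<n. upper_variation M \<nu> (A i)) \<le> upper_variation M \<nu> (\<Union>i. A i)" for n
      by (rule order_trans[OF fin upper_variation_mono]) auto
  qed simp
  show "upper_variation M \<nu> (\<Union>i. A i) \<le> (\<Sum>i. upper_variation M \<nu> (A i))"
  proof (rule upper_variation_le)
    fix B assume B: "B \<in> sets M" "B \<subseteq> (\<Union>i. A i)"
    have "(\<lambda>i. \<nu> (B \<inter> A i)) sums \<nu> (\<Union>i. B \<inter> A i)"
      using A B by (intro signed_measure_sums[OF assms]) (auto simp: disjoint_family_on_def)
    moreover have "(\<Union>i. B \<inter> A i) = B" using B by auto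
    ultimately have s: "(\<lambda>i. \<nu> (B \<inter> A i)) sums \<nu> B" by simp
    have le: "ennreal (\<Sum>i<n. \<nu> (B \<inter> A i)) \<le> (\<Sum>i. upper_variation M \<nu> (A i))" for n
    proof -
      have "ennreal (\<Sum>i<n. \<nu> (B \<inter> A i)) \<le> ennreal (\<Sum>i<n. max 0 (\<nu> (B \<inter> A i)))"
        by (intro ennreal_leI sum_mono) auto
      also have "\<dots> = (\<Sum>i<n. ennreal (\<nu> (B \<inter> A i)))"
        by (subst sum_ennreal[symmetric]) (auto simp: ennreal_max_0)
      also have "\<dots> \<le> (\<Sum>i<n. upper_variation M \<nu> (A i))"
        using A B by (intro sum_mono upper_variation_ge) auto
      also have "\<dots> \<le> (\<Sum>i. upper_variation M \<nu> (A i))"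
        by (intro sum_le_suminf) auto
      finally show ?thesis .
    qed
    have "(\<lambda>n. ennreal (\<Sum>i<n. \<nu> (B \<inter> A i))) \<longlonglongrightarrow> ennreal (\<nu> B)"
      using s unfolding sums_def by (intro tendsto_ennrealI)
    then show "ennreal (\<nu> B) \<le> (\<Sum>i. upper_variation M \<nu> (A i))"
      by (rule LIMSEQ_le_const2) (use le in auto)
  qed
qed

lemma sets_pos_part [simp]: "sets (pos_part M \<nu>) = sets M"
  by (simp add: pos_part_def)

lemma space_pos_part [simp]: "space (pos_part M \<nu>) = space M"
  by (simp add: pos_part_def)

lemma emeasure_pos_part:
  assumes "signed_measure M \<nu>" "A \<in> sets M"
  shows "emeasure (pos_part M \<nu>) A = upper_variation M \<nu> A"
  unfolding pos_part_def
  using assms upper_variation_countably_additive[OF assms(1)]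
  by (intro emeasure_measure_of_sigma)
     (auto simp: sets.sigma_algebra_axioms positive_def upper_variation_empty)

text \<open>
  Iterating this splitting off produces infinitely many disjoint sets of measure at least \<open>1\<close> in
  absolute value, so real-valued signed measures are bounded.
\<close>

lemma signed_measure_unbounded_split:
  assumes \<nu>: "signed_measure M \<nu>" and E: "E \<in> sets M"
    and unb: "\<And>K. \<exists>B\<in>sets M. B \<subseteq> E \<and> \<bar>\<nu> B\<bar> > K"
  shows "\<exists>F\<in>sets M. F \<subseteq> E \<and> (\<forall>K. \<exists>B\<in>sets M. B \<subseteq> F \<and> \<bar>\<nu> B\<bar> > K) \<and> 1 \<le> \<bar>\<nu> (E - F)\<bar>"
proof -
  \<comment> \<open>Exceeding \<open>1 + \<bar>\<nu> E\<bar>\<close> makes both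
    \<open>\<bar>\<nu> A\<bar>\<close> and \<open>\<bar>\<nu> (E - A)\<bar>\<close> larger than 1,
    so whichever piece is unbounded can be kept and the other one split off.\<close>
  obtain A where A: "A \<in> sets M" "A \<subseteq> E" "\<bar>\<nu> A\<bar> > 1 + \<bar>\<nu> E\<bar>" using unb by blast
  have D: "\<nu> (E - A) = \<nu> E - \<nu> A" using signed_measure_Diff[OF \<nu> E A(1,2)] .
  show ?thesis
  proof (cases "\<forall>K. \<exists>B\<in>sets M. B \<subseteq> E - A \<and> \<bar>\<nu> B\<bar> > K")
    case True
    have "E - (E - A) = A" using A by auto
    then show ?thesis using True A E by (intro bexI[of _ "E - A"]) auto
  next
    case False
    then obtain K' where K': "\<And>B. B \<in> sets M \<Longrightarrow> B \<subseteq> E - A \<Longrightarrow> \<bar>\<nu> B\<bar> \<le> K'"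
      by (meson not_less)
    have "\<exists>B\<in>sets M. B \<subseteq> A \<and> \<bar>\<nu> B\<bar> > K" for K
    proof -
      obtain B where B: "B \<in> sets M" "B \<subseteq> E" "\<bar>\<nu> B\<bar> > K + K'" using unb by blast
      have "\<nu> ((B \<inter> A) \<union> (B - A)) = \<nu> (B \<inter> A) + \<nu> (B - A)"
        using A B by (intro signed_measure_Un[OF \<nu>]) auto
      moreover have "(B \<inter> A) \<union> (B - A) = B" by auto
      moreover have "\<bar>\<nu> (B - A)\<bar> \<le> K'" using A B by (intro K') auto
      ultimately have "\<bar>\<nu> (B \<inter> A)\<bar> > K" using B(3) by simp
      then show ?thesis using A B by (intro bexI[of _ "B \<inter> A"]) auto
    qed
    then show ?thesis using A D by (intro bexI[of _ A]) auto
  qed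
qed

lemma signed_measure_bounded:
  assumes \<nu>: "signed_measure M \<nu>"
  obtains K where "\<And>B. B \<in> sets M \<Longrightarrow> \<bar>\<nu> B\<bar> \<le> K"
proof (rule ccontr)
  assume "\<not> thesis"
  then have unb0: "\<forall>K. \<exists>B\<in>sets M. B \<subseteq> space M \<and> \<bar>\<nu> B\<bar> > K"
    using that sets.sets_into_space by (meson not_less)
  define Q where "Q F \<longleftrightarrow> F \<in> sets M \<and> (\<forall>K. \<exists>B\<in>sets M. B \<subseteq> F \<and> \<bar>\<nu> B\<bar> > K)" for F
  have "\<exists>E. \<forall>n. Q (E n) \<and> E (Suc n) \<subseteq> E n \<and> 1 \<le> \<bar>\<nu> (E n - E (Suc n))\<bar>"
  proof (rule dependent_nat_choice)
    show "\<exists>F. Q F" using unb0 by (auto simp: Q_def)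
    show "\<exists>F. Q F \<and> F \<subseteq> E \<and> 1 \<le> \<bar>\<nu> (E - F)\<bar>" if "Q E" for E
      using signed_measure_unbounded_split[OF \<nu>, of E] that unfolding Q_def by blast
  qed
  then obtain E where E: "\<And>n. Q (E n)" "\<And>n. E (Suc n) \<subseteq> E n"
    "\<And>n. 1 \<le> \<bar>\<nu> (E n - E (Suc n))\<bar>"
    by blast
  have dec: "m \<le> n \<Longrightarrow> E n \<subseteq> E m" for m n
    using lift_Suc_antimono_le[of E] E(2) by blast
  have "disjoint_family (\<lambda>n. E n - E (Suc n))"
    unfolding disjoint_family_on_def
  proof (intro ballI impI)
    fix m n :: nat assume "m \<noteq> n"
    then consider "Suc m \<le> n" | "Suc n \<le> m" by linarith
    then show "(E m - E (Suc m)) \<inter> (E n - E (Suc n)) = {}"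
      by cases (use dec in blast)+
  qed
  moreover have "range (\<lambda>n. E n - E (Suc n)) \<subseteq> sets M" using E(1) by (auto simp: Q_def)
  ultimately have "(\<lambda>n. \<nu> (E n - E (Suc n))) sums \<nu> (\<Union>n. E n - E (Suc n))"
    by (intro signed_measure_sums[OF \<nu>])
  then have "(\<lambda>n. \<nu> (E n - E (Suc n))) \<longlonglongrightarrow> 0"
    using sums_summable summable_LIMSEQ_zero by blast
  then have "(\<lambda>n. \<bar>\<nu> (E n - E (Suc n))\<bar>) \<longlonglongrightarrow> 0"
    using tendsto_rabs_zero by blast
  then have "1 \<le> (0::real)" by (rule LIMSEQ_le_const) (use E(3) in auto)
  then show False by simp
qed

lemma upper_variation_finite:
  assumes "signed_measure M \<nu>"
  shows "upper_variation M \<nu> A < \<infinity>"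
proof -
  obtain K where K: "\<And>B. B \<in> sets M \<Longrightarrow> \<bar>\<nu> B\<bar> \<le> K"
    using signed_measure_bounded[OF assms] by blast
  have "upper_variation M \<nu> A \<le> ennreal K"
    using K by (intro upper_variation_le ennreal_leI) (metis abs_le_D1)
  then show ?thesis by (simp add: order.strict_trans1)
qed

lemma finite_measure_pos_part: "signed_measure M \<nu> \<Longrightarrow> finite_measure (pos_part M \<nu>)"
  using upper_variation_finite[of M \<nu> "space M"]
  by (intro finite_measureI) (simp add: emeasure_pos_part)

text \<open>For B inside A, \<open>\<nu> B = \<nu> A - \<nu> (A - B)\<close> is at most
  \<open>\<nu> A\<close> plus the upper variation of \<open>- \<nu>\<close>. The supremum over B
  gives one inequality, the same argument for \<open>- \<nu>\<close> the other.\<close>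

lemma upper_variation_uminus:
  assumes \<nu>: "signed_measure M \<nu>" and A: "A \<in> sets M"
  shows "enn2real (upper_variation M \<nu> A) - enn2real (upper_variation M (\<lambda>A. - \<nu> A) A) = \<nu> A"
proof -
  have *: "enn2real (upper_variation M \<nu> A) \<le> \<nu> A + enn2real (upper_variation M (\<lambda>A. - \<nu> A) A)"
    if \<nu>: "signed_measure M \<nu>" for \<nu>
  proof -
    define v where "v = enn2real (upper_variation M (\<lambda>A. - \<nu> A) A)"
    have v: "ennreal v = upper_variation M (\<lambda>A. - \<nu> A) A"
      using upper_variation_finite[OF signed_measure_uminus[OF \<nu>]] by (simp add: v_def)
    have v0: "v \<ge> 0" by (simp add: v_def)
    have le: "- \<nu> B \<le> v" if "B \<in> sets M" "B \<subseteq> A" for B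
      using upper_variation_ge[OF that, of "\<lambda>A. - \<nu> A"] v0 unfolding v[symmetric]
      by (cases "- \<nu> B \<ge> 0") (auto simp: ennreal_le_iff)
    have up: "\<nu> B \<le> \<nu> A + v" if "B \<in> sets M" "B \<subseteq> A" for B
      using signed_measure_Diff[OF \<nu> A that] le[of "A - B"] that A by auto
    have "\<nu> A + v \<ge> 0" using le[of A] A by simp
    moreover have "upper_variation M \<nu> A \<le> ennreal (\<nu> A + v)"
      using up by (intro upper_variation_le ennreal_leI) auto
    ultimately show ?thesis
      unfolding v_def[symmetric] by (metis enn2real_leI)
  qed
  show ?thesis using *[OF \<nu>] *[OF signed_measure_uminus[OF \<nu>]] by simp
qed

lemma signed_measure_jordan:
  assumes "signed_measure M \<nu>" "A \<in> sets M"
  shows "\<nu> A = measure (pos_part M \<nu>) A - measure (neg_part M \<nu>) A"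
  using assms by (simp add: measure_def neg_part_def emeasure_pos_part signed_measure_uminus
      upper_variation_uminus)

lemma sets_neg_part [simp]: "sets (neg_part M \<nu>) = sets M"
  by (simp add: neg_part_def)

lemma space_neg_part [simp]: "space (neg_part M \<nu>) = space M"
  by (simp add: neg_part_def)

lemma finite_measure_neg_part: "signed_measure M \<nu> \<Longrightarrow> finite_measure (neg_part M \<nu>)"
  unfolding neg_part_def by (intro finite_measure_pos_part signed_measure_uminus)

lemma tv_norm_eq:
  assumes "signed_measure M \<nu>"
  shows "tv_norm M \<nu> =
    upper_variation M \<nu> (space M) + upper_variation M (\<lambda>A. - \<nu> A) (space M)"
  using assms by (simp add: tv_norm_def neg_part_def emeasure_pos_part signed_measure_uminus)

lemma signed_integral_indicator:
  assumes "signed_measure M \<nu>" "A \<in> sets M" "\<And>x. x \<in> space M \<Longrightarrow> h x = indicator A x"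
  shows "signed_integral M \<nu> h = \<nu> A"
proof -
  have "integral\<^sup>L N h = measure N A" if "finite_measure N" "sets N = sets M" for N
  proof -
    have "integral\<^sup>L N h = integral\<^sup>L N (indicator A)"
      using assms(3) sets_eq_imp_space_eq[OF that(2)] by (intro Bochner_Integration.integral_cong) auto
    also have "\<dots> = measure N A"
      using sets.sets_into_space[OF assms(2)] sets_eq_imp_space_eq[OF that(2)] by (simp add: Int_absorb2)
    finally show ?thesis .
  qed
  then show ?thesis
    using finite_measure_pos_part[OF assms(1)] finite_measure_neg_part[OF assms(1)]
    by (simp add: signed_integral_def signed_measure_jordan[OF assms(1,2)])
qed

text \<open>Linear identities between indicators pass to signed measures by integration against both
  Jordan parts. This carries the three cancellations of the proof: the corner sum of a quasi-volume,
  the signed cells of a split and the expansion of a basis function.\<close>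

lemma signed_measure_indicator_sum:
  assumes \<nu>: "signed_measure M \<nu>" and fin: "finite I" "finite J"
    and A: "\<And>i. i \<in> I \<Longrightarrow> A i \<in> sets M" and B: "\<And>j. j \<in> J \<Longrightarrow> B j \<in> sets M"
    and eq: "\<And>x. x \<in> space M \<Longrightarrow>
      (\<Sum>i\<in>I. c i * indicator (A i) x) = (\<Sum>j\<in>J. e j * indicator (B j) x :: real)"
  shows "(\<Sum>i\<in>I. c i * \<nu> (A i)) = (\<Sum>j\<in>J. e j * \<nu> (B j))"
proof -
  have int: "integral\<^sup>L N (\<lambda>x. \<Sum>i\<in>I. c i * indicator (A i) x) = (\<Sum>i\<in>I. c i * measure N (A i))"
    if "finite_measure N" "sets N = sets M" "\<And>i. i \<in> I \<Longrightarrow> A i \<in> sets M"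
    for N and I :: "'z set" and c A
  proof -
    interpret finite_measure N by fact
    have "integral\<^sup>L N (\<lambda>x. \<Sum>i\<in>I. c i * indicator (A i) x) =
        (\<Sum>i\<in>I. integral\<^sup>L N (\<lambda>x. c i * indicator (A i) x))"
      using that by (intro Bochner_Integration.integral_sum integrable_mult_right
          integrable_real_indicator) (auto simp: less_top[symmetric])
    also have "\<dots> = (\<Sum>i\<in>I. c i * measure N (A i))"
      using that(3) sets.sets_into_space sets_eq_imp_space_eq[OF that(2)]
      by (intro sum.cong) (auto simp: Int_absorb2)
    finally show ?thesis .
  qed
  have *: "(\<Sum>i\<in>I. c i * measure N (A i)) = (\<Sum>j\<in>J. e j * measure N (B j))"
    if "finite_measure N" "sets N = sets M" for N
  proof -
    have "integral\<^sup>L N (\<lambda>x. \<Sum>i\<in>I. c i * indicator (A i) x) =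
        integral\<^sup>L N (\<lambda>x. \<Sum>j\<in>J. e j * indicator (B j) x)"
      using eq sets_eq_imp_space_eq[OF that(2)] by (intro Bochner_Integration.integral_cong) auto
    then show ?thesis
      using int[OF that, of I A c] int[OF that, of J B e] A B by simp
  qed
  show ?thesis
    using *[OF finite_measure_pos_part[OF \<nu>]] *[OF finite_measure_neg_part[OF \<nu>]] A B
    by (simp add: signed_measure_jordan[OF \<nu>] right_diff_distrib sum_subtractf)
qed

section \<open>Bounds for the total variation norm\<close>

lemma upper_variation_sum_le:
  assumes "finite I"
  shows "upper_variation M (\<lambda>A. \<Sum>i\<in>I. \<nu> i A) X \<le> (\<Sum>i\<in>I. upper_variation M (\<nu> i) X)"
proof (rule upper_variation_le)
  fix B assume B: "B \<in> sets M" "B \<subseteq> X"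
  have "ennreal (\<Sum>i\<in>I. \<nu> i B) \<le> ennreal (\<Sum>i\<in>I. max 0 (\<nu> i B))"
    by (intro ennreal_leI sum_mono) auto
  also have "\<dots> = (\<Sum>i\<in>I. ennreal (\<nu> i B))"
    by (subst sum_ennreal[symmetric]) (auto simp: ennreal_max_0)
  also have "\<dots> \<le> (\<Sum>i\<in>I. upper_variation M (\<nu> i) X)"
    using B by (intro sum_mono upper_variation_ge) auto
  finally show "ennreal (\<Sum>i\<in>I. \<nu> i B) \<le> (\<Sum>i\<in>I. upper_variation M (\<nu> i) X)" .
qed

lemma tv_norm_sum_le:
  assumes "finite I" "\<And>i. i \<in> I \<Longrightarrow> signed_measure M (\<nu> i)"
  shows "tv_norm M (\<lambda>A. \<Sum>i\<in>I. \<nu> i A) \<le> (\<Sum>i\<in>I. tv_norm M (\<nu> i))"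
  using add_mono[OF upper_variation_sum_le[OF assms(1), of M \<nu> "space M"]
      upper_variation_sum_le[OF assms(1), of M "\<lambda>i A. - \<nu> i A" "space M"]] assms
  by (simp add: tv_norm_eq signed_measure_sum sum_negf sum.distrib)

lemma tv_norm_sign:
  assumes "signed_measure M \<nu>" "c = 1 \<or> c = -1"
  shows "tv_norm M (\<lambda>A. c * \<nu> A) = tv_norm M \<nu>"
  using assms by (auto simp: tv_norm_eq signed_measure_uminus add.commute)

text \<open>Every competitor on \<open>N\<close> pulls back to a competitor on \<open>M\<close> of
  the same value.\<close>

lemma tv_norm_push_le:
  assumes "signed_measure M \<nu>" "\<phi> \<in> measurable M N" "D \<in> sets M"
  shows "tv_norm N (\<lambda>B. \<nu> (\<phi> -` B \<inter> D)) \<le> tv_norm M \<nu>"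
proof -
  have m: "\<phi> -` B \<inter> D \<in> sets M" if "B \<in> sets N" for B
  proof -
    have "\<phi> -` B \<inter> space M \<inter> D \<in> sets M"
      using that assms by (intro sets.Int measurable_sets[OF assms(2)]) auto
    then show ?thesis
      using sets.sets_into_space[OF assms(3)] by (simp add: Int_assoc inf.absorb2)
  qed
  have "upper_variation N (\<lambda>B. \<nu> (\<phi> -` B \<inter> D)) (space N) \<le> upper_variation M \<nu> (space M)" for \<nu>
    using m sets.sets_into_space by (intro upper_variation_le upper_variation_ge) blast+
  then show ?thesis
    unfolding tv_norm_eq[OF assms(1)] tv_norm_eq[OF signed_measure_push[OF assms]]
    by (intro add_mono)
qed

lemma tv_norm_zero: "tv_norm M (\<lambda>A. 0) = 0"
  unfolding tv_norm_eq[OF signed_measure_zero]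
  by (simp add: upper_variation_le[of M _ _ 0, simplified])

lemma tv_norm_dirac_le: "tv_norm M (\<lambda>B. indicator B z) \<le> 1"
proof -
  have "upper_variation M (\<lambda>B. indicator B z) (space M) \<le> 1"
    by (rule upper_variation_le) (auto simp: indicator_def)
  moreover have "upper_variation M (\<lambda>B. - indicator B z) (space M) \<le> 0"
    by (rule upper_variation_le) (auto simp: ennreal_neg)
  ultimately show ?thesis
    unfolding tv_norm_eq[OF signed_measure_dirac] using add_mono by fastforce
qed

lemma signed_measure_sub_eq:
  assumes "signed_measure M \<nu>" "A \<in> sets M" "B \<in> sets M"
  shows "\<nu> A - \<nu> B = \<nu> (A - B) - \<nu> (B - A)"
proof -
  have "\<nu> ((A - B) \<union> (A \<inter> B)) = \<nu> (A - B) + \<nu> (A \<inter> B)"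
    "\<nu> ((B - A) \<union> (A \<inter> B)) = \<nu> (B - A) + \<nu> (A \<inter> B)"
    using assms by (intro signed_measure_Un[OF assms(1)]; auto)+
  moreover have "(A - B) \<union> (A \<inter> B) = A" "(B - A) \<union> (A \<inter> B) = B" by auto
  ultimately show ?thesis by simp
qed

text \<open>The common part of \<open>A\<close> and \<open>B\<close> cancels, \<open>A - B\<close>
  is charged to the positive and \<open>B - A\<close> to the negative variation, so one norm
  suffices instead of two. All lower bounds on norms in the extremal examples come from
  here.\<close>

lemma tv_norm_ge_diff:
  assumes "signed_measure M \<nu>" "A \<in> sets M" "B \<in> sets M"
  shows "ennreal (\<nu> A - \<nu> B) \<le> tv_norm M \<nu>"
proof -
  have "ennreal (\<nu> A - \<nu> B) \<le> ennreal (max 0 (\<nu> (A - B)) + max 0 (- \<nu> (B - A)))"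
    unfolding signed_measure_sub_eq[OF assms] by (intro ennreal_leI) auto
  also have "\<dots> = ennreal (\<nu> (A - B)) + ennreal (- \<nu> (B - A))"
    by (simp add: ennreal_max_0)
  also have "\<dots> \<le> tv_norm M \<nu>"
    unfolding tv_norm_eq[OF assms(1)] using assms sets.sets_into_space
    by (intro add_mono upper_variation_ge) blast+
  finally show ?thesis .
qed

section \<open>The total variation measure and axis-aligned splits\<close>

text \<open>This is |nu|. Having it as a measure gives access to additivity over cells, continuity
  from below and approximation of sets by grids.\<close>

definition var_measure :: "'a measure \<Rightarrow> ('a set \<Rightarrow> real) \<Rightarrow> 'a measure" where
  "var_measure M \<nu> = measure_of (space M) (sets M)
     (\<lambda>A. emeasure (pos_part M \<nu>) A + emeasure (neg_part M \<nu>) A)"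

lemma sets_var_measure [simp]: "sets (var_measure M \<nu>) = sets M"
  by (simp add: var_measure_def)

lemma space_var_measure [simp]: "space (var_measure M \<nu>) = space M"
  by (simp add: var_measure_def)

lemma emeasure_var_measure:
  assumes "A \<in> sets M"
  shows "emeasure (var_measure M \<nu>) A = emeasure (pos_part M \<nu>) A + emeasure (neg_part M \<nu>) A"
  unfolding var_measure_def
proof (rule emeasure_measure_of_sigma)
  show "countably_additive (sets M) (\<lambda>A. emeasure (pos_part M \<nu>) A + emeasure (neg_part M \<nu>) A)"
    unfolding countably_additive_def
  proof (intro allI impI)
    fix A :: "nat \<Rightarrow> 'a set" assume A: "range A \<subseteq> sets M" "disjoint_family A"
    have "(\<Sum>i. emeasure (pos_part M \<nu>) (A i) + emeasure (neg_part M \<nu>) (A i)) =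
        (\<Sum>i. emeasure (pos_part M \<nu>) (A i)) + (\<Sum>i. emeasure (neg_part M \<nu>) (A i))"
      by (rule suminf_add[symmetric]) auto
    then show "(\<Sum>i. emeasure (pos_part M \<nu>) (A i) + emeasure (neg_part M \<nu>) (A i)) =
        emeasure (pos_part M \<nu>) (\<Union>i. A i) + emeasure (neg_part M \<nu>) (\<Union>i. A i)"
      using A by (simp add: suminf_emeasure)
  qed
qed (use assms in \<open>auto simp: sets.sigma_algebra_axioms positive_def\<close>)

lemma emeasure_var_measure_space:
  "emeasure (var_measure M \<nu>) (space M) = tv_norm M \<nu>"
  by (simp add: emeasure_var_measure tv_norm_def)

lemma finite_measure_var_measure:
  assumes "signed_measure M \<nu>"
  shows "finite_measure (var_measure M \<nu>)"
proof (rule finite_measureI)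
  show "emeasure (var_measure M \<nu>) (space (var_measure M \<nu>)) \<noteq> \<infinity>"
    using finite_measure.emeasure_finite[OF finite_measure_pos_part[OF assms]]
      finite_measure.emeasure_finite[OF finite_measure_neg_part[OF assms]]
    by (simp add: emeasure_var_measure)
qed

lemma signed_measure_abs_le:
  assumes "signed_measure M \<nu>" "A \<in> sets M"
  shows "\<bar>\<nu> A\<bar> \<le> measure (var_measure M \<nu>) A"
proof -
  interpret p: finite_measure "pos_part M \<nu>" by (rule finite_measure_pos_part) fact
  interpret n: finite_measure "neg_part M \<nu>" by (rule finite_measure_neg_part) fact
  have "measure (var_measure M \<nu>) A = measure (pos_part M \<nu>) A + measure (neg_part M \<nu>) A"
    unfolding measure_def using assms by (simp add: emeasure_var_measure enn2real_plus less_top[symmetric])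
  then show ?thesis
    using signed_measure_jordan[OF assms]
    by (metis abs_of_nonneg abs_triangle_ineq4 measure_nonneg)
qed

section \<open>Half-open boxes and the cells of a split\<close>

abbreviation borel_vecs :: "nat set \<Rightarrow> (nat \<Rightarrow> real) measure" where
  "borel_vecs S \<equiv> PiM S (\<lambda>_. borel)"

lemma space_borel_vecs: "space (borel_vecs S) = vecs S"
  by (simp add: space_PiM)

text \<open>Open below and closed above: these are the thresholds crossed between \<open>u\<close>
  and \<open>v\<close> under both anchor conventions, and such boxes tile without sharing
  faces.\<close>

definition half_box :: "nat set \<Rightarrow> (nat \<Rightarrow> real) \<Rightarrow> (nat \<Rightarrow> real) \<Rightarrow> (nat \<Rightarrow> real) set" where
  "half_box S u v = PiE S (\<lambda>j. {u j<..v j})"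

lemma half_box_sets [measurable]: "finite S \<Longrightarrow> half_box S u v \<in> sets (borel_vecs S)"
  unfolding half_box_def by (intro sets_PiM_I_finite) auto

lemma mem_half_box: "w \<in> vecs S \<Longrightarrow> w \<in> half_box S u v \<longleftrightarrow> (\<forall>j\<in>S. u j < w j \<and> w j \<le> v j)"
  by (auto simp: half_box_def PiE_iff)

lemma indicator_PiE:
  assumes "finite S" "w \<in> vecs S"
  shows "indicator (PiE S A) w = (\<Prod>j\<in>S. indicator (A j) (w j) :: 'a::{comm_semiring_1})"
proof (cases "\<forall>j\<in>S. w j \<in> A j")
  case True
  then show ?thesis using assms by (auto simp: PiE_iff indicator_def)
next
  case False
  then have "(\<Prod>j\<in>S. indicator (A j) (w j) :: 'a) = 0"
    using assms(1) by (auto simp: indicator_def intro!: prod_zero)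
  then show ?thesis using False by (auto simp: PiE_iff indicator_def)
qed

lemma partition_mono:
  fixes u :: "nat \<Rightarrow> real"
  assumes "\<forall>k\<in>{1..n}. u k < u (k + 1)" "1 \<le> i" "i \<le> j" "j \<le> n + 1"
  shows "u i \<le> u j"
  using assms(3,4)
proof (induction j rule: dec_induct)
  case (step k)
  then have "u k < u (k + 1)" using assms(1,2) by auto
  then show ?case using step by simp
qed simp

lemma partition_cell:
  fixes u :: "nat \<Rightarrow> real"
  assumes "\<forall>k\<in>{1..n}. u k < u (k + 1)" "u 1 < x" "x \<le> u (n + 1)"
  shows "\<exists>k\<in>{1..n}. u k < x \<and> x \<le> u (k + 1)"
proof -
  \<comment> \<open>The first right end point at or beyond \<open>x\<close>, counted from 0; the
    value 0 is excluded by \<open>u 1 < x\<close>.\<close>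
  define k where "k = (LEAST k. x \<le> u (k + 1))"
  have k: "x \<le> u (k + 1)" unfolding k_def by (rule LeastI) (rule assms(3))
  have "k \<le> n" unfolding k_def by (rule Least_le) (rule assms(3))
  moreover have "k \<noteq> 0" using k assms(2) by (auto intro: ccontr)
  moreover have "\<not> x \<le> u ((k - 1) + 1)"
    using not_less_Least[of "k - 1" "\<lambda>k. x \<le> u (k + 1)"] \<open>k \<noteq> 0\<close> unfolding k_def by auto
  ultimately show ?thesis using k by (intro bexI[of _ k]) auto
qed

lemma partition_cell_unique:
  fixes u :: "nat \<Rightarrow> real"
  assumes "\<forall>k\<in>{1..n}. u k < u (k + 1)" "k \<in> {1..n}" "k' \<in> {1..n}"
    "u k < x" "x \<le> u (k + 1)" "u k' < x" "x \<le> u (k' + 1)"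
  shows "k = k'"
proof (rule ccontr)
  assume "k \<noteq> k'"
  then consider "k + 1 \<le> k'" | "k' + 1 \<le> k" by linarith
  then show False
    using partition_mono[OF assms(1), of "k + 1" k'] partition_mono[OF assms(1), of "k' + 1" k] assms
    by cases auto
qed

text \<open>The closed rectangles of a split share faces. Their half-open versions partition the
  large half-open box exactly, which turns sums over cells into measures of sets.\<close>

lemma split_cells:
  assumes "finite S" and P: "P \<in> axis_aligned_splits S a b"
  shows "finite P"
    and "\<And>R. R \<in> P \<Longrightarrow> \<forall>j\<in>S. fst R j < snd R j"
    and "\<And>w R R'. w \<in> vecs S \<Longrightarrow> R \<in> P \<Longrightarrow> R' \<in> P \<Longrightarrow> w \<in> half_box S (fst R) (snd R) \<Longrightarrow>
      w \<in> half_box S (fst R') (snd R') \<Longrightarrow> R = R'"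
    and "\<And>R. R \<in> P \<Longrightarrow> half_box S (fst R) (snd R) \<subseteq> half_box S a b"
    and "\<And>w. w \<in> half_box S a b \<Longrightarrow> \<exists>R\<in>P. w \<in> half_box S (fst R) (snd R)"
proof -
  obtain n :: "nat \<Rightarrow> nat" and u :: "nat \<Rightarrow> nat \<Rightarrow> real" where Peq: "P = (\<lambda>l. (\<lambda>j\<in>S. u j (l j), \<lambda>j\<in>S. u j (l j + 1))) ` PiE S (\<lambda>j. {1..n j})"
    and nu: "\<forall>j\<in>S. 1 \<le> n j \<and> u j 1 = a j \<and> u j (n j + 1) = b j \<and>
              (\<forall>k\<in>{1..n j}. u j k < u j (k + 1))"
    using P unfolding axis_aligned_splits_def  by blast
  show "finite P" unfolding Peq using assms(1) by (intro finite_imageI finite_PiE) auto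
  show "\<forall>j\<in>S. fst R j < snd R j" if "R \<in> P" for R
    using that nu unfolding Peq by (auto simp: PiE_iff)
  show "R = R'" if w: "w \<in> vecs S" and R: "R \<in> P" "R' \<in> P"
    "w \<in> half_box S (fst R) (snd R)" "w \<in> half_box S (fst R') (snd R')" for w R R'
  proof -
    obtain l l' where l: "l \<in> PiE S (\<lambda>j. {1..n j})" "R = (\<lambda>j\<in>S. u j (l j), \<lambda>j\<in>S. u j (l j + 1))"
      "l' \<in> PiE S (\<lambda>j. {1..n j})" "R' = (\<lambda>j\<in>S. u j (l' j), \<lambda>j\<in>S. u j (l' j + 1))"
      using R(1,2) unfolding Peq by blast
    have "l j = l' j" if "j \<in> S" for j
      using partition_cell_unique[of "n j" "u j" "l j" "l' j" "w j"] nu l that R(3,4)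
      by (simp add: mem_half_box[OF w] PiE_iff)
    then have "l = l'" by (rule PiE_ext[OF l(1,3)])
    then show ?thesis using l by simp
  qed
  show "half_box S (fst R) (snd R) \<subseteq> half_box S a b" if R: "R \<in> P" for R
  proof -
    obtain l where l: "l \<in> PiE S (\<lambda>j. {1..n j})" "R = (\<lambda>j\<in>S. u j (l j), \<lambda>j\<in>S. u j (l j + 1))"
      using R unfolding Peq by blast
    have "a j \<le> u j (l j) \<and> u j (l j + 1) \<le> b j" if "j \<in> S" for j
      using partition_mono[of "n j" "u j" 1 "l j"] partition_mono[of "n j" "u j" "l j + 1" "n j + 1"]
        nu l(1) that by (auto simp: PiE_iff)
    then show ?thesis unfolding half_box_def l by (intro PiE_mono) (auto, force+)
  qed
  show "\<exists>R\<in>P. w \<in> half_box S (fst R) (snd R)" if w: "w \<in> half_box S a b" for w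
  proof -
    have wv: "w \<in> vecs S" using w by (auto simp: half_box_def PiE_iff)
    have "\<exists>k\<in>{1..n j}. u j k < w j \<and> w j \<le> u j (k + 1)" if "j \<in> S" for j
      using w nu that by (intro partition_cell) (auto simp: mem_half_box[OF wv])
    then obtain l where l: "\<And>j. j \<in> S \<Longrightarrow> l j \<in> {1..n j} \<and> u j (l j) < w j \<and> w j \<le> u j (l j + 1)"
      by metis
    define R where "R = (\<lambda>j\<in>S. u j (restrict l S j), \<lambda>j\<in>S. u j (restrict l S j + 1))"
    have "R \<in> P" unfolding Peq R_def using l by (intro imageI) auto
    moreover have "w \<in> half_box S (fst R) (snd R)"
      using l by (auto simp: mem_half_box[OF wv] R_def)
    ultimately show ?thesis by blast
  qed
qed

text \<open>
  The sets determined by finitely many axis-parallel cuts form an algebra generating the Borel sets,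
  and each of them is, inside a large cube, a union of cells of an axis-aligned split.
\<close>

definition cut_determined :: "nat set \<Rightarrow> real set \<Rightarrow> (nat \<Rightarrow> real) set \<Rightarrow> bool" where
  "cut_determined S C E \<longleftrightarrow> (\<forall>w\<in>vecs S. \<forall>w'\<in>vecs S.
     (\<forall>j\<in>S. \<forall>c\<in>C. w j \<le> c \<longleftrightarrow> w' j \<le> c) \<longrightarrow> (w \<in> E \<longleftrightarrow> w' \<in> E))"

lemma cut_determinedD:
  assumes "cut_determined S C E" "w \<in> vecs S" "w' \<in> vecs S"
    "\<And>j c. j \<in> S \<Longrightarrow> c \<in> C \<Longrightarrow> w j \<le> c \<longleftrightarrow> w' j \<le> c"
  shows "w \<in> E \<longleftrightarrow> w' \<in> E"
  using assms unfolding cut_determined_def by blast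

text \<open>Approximability in the pseudometric Q(B \<Delta> E). Measurability of \<open>B\<close>
  is included so that an induction over a generated sigma-algebra carries it along.\<close>

definition cut_approx :: "nat set \<Rightarrow> (nat \<Rightarrow> real) measure \<Rightarrow> (nat \<Rightarrow> real) set \<Rightarrow> bool" where
  "cut_approx S Q B \<longleftrightarrow> B \<in> sets Q \<and> (\<forall>\<epsilon>>0. \<exists>C E. finite C \<and> cut_determined S C E \<and> E \<in> sets Q \<and>
     measure Q (sym_diff B E) < \<epsilon>)"

context
  fixes S :: "nat set" and Q :: "(nat \<Rightarrow> real) measure"
  assumes Q: "finite_measure Q" "sets Q = sets (borel_vecs S)"
begin

interpretation finite_measure Q by (rule Q)

private lemma space_Q: "space Q = vecs S"
  using sets_eq_imp_space_eq[OF Q(2)] by (simp add: space_borel_vecs)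

lemma cut_approx_exact:
  assumes "B \<in> sets Q" "finite C" "cut_determined S C B"
  shows "cut_approx S Q B"
  unfolding cut_approx_def using assms by (auto intro!: exI[of _ C] exI[of _ B])

lemma cut_approx_Compl:
  assumes "cut_approx S Q B"
  shows "cut_approx S Q (space Q - B)"
  unfolding cut_approx_def
proof (intro conjI allI impI)
  show "space Q - B \<in> sets Q" using assms by (auto simp: cut_approx_def)
  fix \<epsilon> :: real assume "\<epsilon> > 0"
  then obtain C E where CE: "finite C" "cut_determined S C E" "E \<in> sets Q" "measure Q (sym_diff B E) < \<epsilon>"
    using assms unfolding cut_approx_def by blast
  have "sym_diff (space Q - B) (space Q - E) = sym_diff B E"
    using CE(3) assms sets.sets_into_space[of _ Q] by (auto simp: cut_approx_def)
  moreover have "cut_determined S C (space Q - E)"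
    using CE(2) unfolding cut_determined_def space_Q by blast
  ultimately show "\<exists>C E. finite C \<and> cut_determined S C E \<and> E \<in> sets Q \<and>
      measure Q (sym_diff (space Q - B) E) < \<epsilon>"
    using CE by (intro exI[of _ C] exI[of _ "space Q - E"]) auto
qed

lemma cut_approx_Un:
  assumes "cut_approx S Q A" "cut_approx S Q B"
  shows "cut_approx S Q (A \<union> B)"
  unfolding cut_approx_def
proof (intro conjI allI impI)
  have AB: "A \<in> sets Q" "B \<in> sets Q" using assms by (auto simp: cut_approx_def)
  then show "A \<union> B \<in> sets Q" by simp
  fix \<epsilon> :: real assume "\<epsilon> > 0"
  then have "\<epsilon> / 2 > 0" by simp
  then obtain C E C' E' where
    CE: "finite C" "cut_determined S C E" "E \<in> sets Q" "measure Q (sym_diff A E) < \<epsilon> / 2"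
    "finite C'" "cut_determined S C' E'" "E' \<in> sets Q" "measure Q (sym_diff B E') < \<epsilon> / 2"
    using assms unfolding cut_approx_def by meson
  have "measure Q (sym_diff (A \<union> B) (E \<union> E')) \<le> measure Q (sym_diff A E \<union> sym_diff B E')"
    using AB CE by (intro finite_measure_mono) auto
  also have "\<dots> \<le> measure Q (sym_diff A E) + measure Q (sym_diff B E')"
    using AB CE by (intro measure_Un_le) auto
  also have "\<dots> < \<epsilon>" using CE by simp
  finally have "measure Q (sym_diff (A \<union> B) (E \<union> E')) < \<epsilon>" .
  moreover have "cut_determined S (C \<union> C') (E \<union> E')"
    unfolding cut_determined_def
  proof (intro ballI impI)
    fix w w' assume w: "w \<in> vecs S" "w' \<in> vecs S"
      and cuts: "\<forall>j\<in>S. \<forall>c\<in>C \<union> C'. (w j \<le> c) = (w' j \<le> c)"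
    have "w \<in> E \<longleftrightarrow> w' \<in> E" using cuts by (intro cut_determinedD[OF CE(2) w]) auto
    moreover have "w \<in> E' \<longleftrightarrow> w' \<in> E'" using cuts by (intro cut_determinedD[OF CE(6) w]) auto
    ultimately show "w \<in> E \<union> E' \<longleftrightarrow> w' \<in> E \<union> E'" by simp
  qed
  ultimately show "\<exists>C E. finite C \<and> cut_determined S C E \<and> E \<in> sets Q \<and>
      measure Q (sym_diff (A \<union> B) E) < \<epsilon>"
    using CE by (intro exI[of _ "C \<union> C'"] exI[of _ "E \<union> E'"]) auto
qed

text \<open>Infinitely many approximants need not share a finite set of cuts. The union is therefore
  truncated, at a cost below \<open>\<epsilon> / 2\<close> by continuity from below, and the finite
  union is approximated up to another \<open>\<epsilon> / 2\<close>.\<close>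

lemma cut_approx_UN:
  assumes "\<And>i::nat. cut_approx S Q (A i)"
  shows "cut_approx S Q (\<Union>i. A i)"
  unfolding cut_approx_def
proof (intro conjI allI impI)
  have A: "A i \<in> sets Q" for i using assms by (auto simp: cut_approx_def)
  then show U: "(\<Union>i. A i) \<in> sets Q" by auto
  fix \<epsilon> :: real assume "\<epsilon> > 0"
  have fin: "cut_approx S Q (\<Union>i<n. A i)" for n
  proof (induction n)
    case 0
    show ?case by (rule cut_approx_exact[of _ "{}"]) (auto simp: cut_determined_def)
  next
    case (Suc n)
    then show ?case using cut_approx_Un[OF assms[of n]] by (simp add: lessThan_Suc)
  qed
  have "(\<lambda>n. measure Q (\<Union>i<n. A i)) \<longlonglongrightarrow> measure Q (\<Union>n. \<Union>i<n. A i)"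
    using A by (intro finite_Lim_measure_incseq) (force simp: incseq_def)+
  moreover have "(\<Union>n. \<Union>i<n. A i) = (\<Union>i. A i)" by auto
  ultimately have "(\<lambda>n. measure Q (\<Union>i<n. A i)) \<longlonglongrightarrow> measure Q (\<Union>i. A i)" by simp
  then have "eventually (\<lambda>n. measure Q (\<Union>i<n. A i) > measure Q (\<Union>i. A i) - \<epsilon> / 2) sequentially"
    using \<open>\<epsilon> > 0\<close> by (intro order_tendstoD) auto
  then obtain n where n: "measure Q (\<Union>i<n. A i) > measure Q (\<Union>i. A i) - \<epsilon> / 2"
    by (auto simp: eventually_sequentially)
  have "\<epsilon> / 2 > 0" using \<open>\<epsilon> > 0\<close> by simp
  with fin[of n] obtain C E where
    CE: "finite C" "cut_determined S C E" "E \<in> sets Q" "measure Q (sym_diff (\<Union>i<n. A i) E) < \<epsilon> / 2"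
    unfolding cut_approx_def by meson
  let ?V = "\<Union>i<n. A i" and ?U = "\<Union>i. A i"
  have V: "?V \<in> sets Q" using A by auto
  have "measure Q (sym_diff ?U E) \<le> measure Q ((?U - ?V) \<union> sym_diff ?V E)"
    using U V CE by (intro finite_measure_mono) auto
  also have "\<dots> \<le> measure Q (?U - ?V) + measure Q (sym_diff ?V E)"
    using U V CE by (intro measure_Un_le) auto
  also have "measure Q (?U - ?V) = measure Q ?U - measure Q ?V"
    using U V by (intro finite_measure_Diff) auto
  finally have "measure Q (sym_diff ?U E) < \<epsilon>" using n CE by simp
  then show "\<exists>C E. finite C \<and> cut_determined S C E \<and> E \<in> sets Q \<and> measure Q (sym_diff ?U E) < \<epsilon>"
    using CE by blast
qed

lemma cut_approx_sigma_sets: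
  assumes "B \<in> sigma_sets (space Q) G" "\<And>B. B \<in> G \<Longrightarrow> cut_approx S Q B"
  shows "cut_approx S Q B"
  using assms(1)
proof (induction rule: sigma_sets.induct)
  case Empty
  show ?case by (rule cut_approx_exact[of _ "{}"]) (auto simp: cut_determined_def)
qed (use assms(2) cut_approx_Compl cut_approx_UN in auto)

text \<open>Generators at two levels: the product sigma-algebra comes from coordinate preimages of
  Borel sets, the Borel sets of the line from half-lines \<open>{..a}\<close>. The preimage of such
  a half-line is determined exactly by the single cut \<open>a\<close>.\<close>

lemma cut_approx_borel:
  assumes "B \<in> sets Q"
  shows "cut_approx S Q B"
proof -
  have one: "cut_approx S Q {w \<in> vecs S. w i \<in> X}" if "i \<in> S" "X \<in> sets borel" for i X
  proof -
    have "X \<in> sigma_sets UNIV (range (\<lambda>a. {..a}))"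
      using that(2) unfolding borel_eq_atMost by simp
    then show ?thesis
    proof (induction rule: sigma_sets.induct)
      case (Basic X)
      then obtain a where X: "X = {..a}" by auto
      have "{w \<in> space (borel_vecs S). w i \<in> {..a}} \<in> sets (borel_vecs S)"
        using that(1) by measurable
      then show ?case
        unfolding X using that(1) Q(2)
        by (intro cut_approx_exact[of _ "{a}"]) (auto simp: cut_determined_def space_borel_vecs)
    next
      case Empty
      show ?case by (rule cut_approx_exact[of _ "{}"]) (auto simp: cut_determined_def)
    next
      case (Compl X)
      moreover have "{w \<in> vecs S. w i \<in> UNIV - X} = space Q - {w \<in> vecs S. w i \<in> X}"
        by (auto simp: space_Q)
      ultimately show ?case using cut_approx_Compl by simp
    next
      case (Union X)
      moreover have "{w \<in> vecs S. w i \<in> \<Union> (range X)} = (\<Union>k. {w \<in> vecs S. w i \<in> X k})"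
        by auto
      ultimately show ?case using cut_approx_UN by simp
    qed
  qed
  have "sets Q = sigma_sets (space Q) {{w \<in> vecs S. w i \<in> X} |i X. i \<in> S \<and> X \<in> sets borel}"
    unfolding Q(2) space_Q by (simp add: sets_PiM_single)
  then show ?thesis
    using assms one by (intro cut_approx_sigma_sets[of B]) auto
qed

end

section \<open>Hardy--Krause variation of anchored representations\<close>

text \<open>A set of thresholds w for a fixed point x: those for which the product over S of the
  anchored indicators, 1(x_j < w_j) at +infinity and 1(x_j >= w_j) at -infinity, equals 1.\<close>

definition orthant :: "(nat \<Rightarrow> ereal) \<Rightarrow> nat set \<Rightarrow> (nat \<Rightarrow> real) \<Rightarrow> (nat \<Rightarrow> real) set" where
  "orthant a S x = PiE S (\<lambda>j. if a j = \<infinity> then {x j<..} else {..x j})"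

lemma orthant_sets [measurable]: "finite S \<Longrightarrow> orthant a S x \<in> sets (borel_vecs S)"
  unfolding orthant_def by (intro sets_PiM_I_finite) auto

lemma mem_orthant:
  "w \<in> vecs S \<Longrightarrow>
    w \<in> orthant a S x \<longleftrightarrow> (\<forall>j\<in>S. (a j = \<infinity> \<longrightarrow> x j < w j) \<and> (a j \<noteq> \<infinity> \<longrightarrow> w j \<le> x j))"
  unfolding orthant_def PiE_iff by (intro iffI conjI ballI) (auto split: if_splits)

lemma orthant_subset: "orthant a S x \<subseteq> vecs S"
  by (auto simp: orthant_def PiE_iff)

lemma orthant_cong: "(\<And>j. j \<in> S \<Longrightarrow> x j = y j) \<Longrightarrow> orthant a S x = orthant a S y"
  unfolding orthant_def by (intro PiE_cong) auto

text \<open>An anchored decomposition: the term of \<open>S\<close> depends only on the coordinates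
  in \<open>S\<close> and tends to 0 when one of them tends to its anchor. Thus \<open>c\<close> is
  the value of \<open>f\<close> at the anchor.\<close>

definition canonical_rep ::
    "nat \<Rightarrow> (nat \<Rightarrow> ereal) \<Rightarrow> real \<Rightarrow> (nat set \<Rightarrow> (nat \<Rightarrow> real) set \<Rightarrow> real) \<Rightarrow>
      ((nat \<Rightarrow> real) \<Rightarrow> real) \<Rightarrow> bool" where
  "canonical_rep d a c \<mu> f \<longleftrightarrow>
     (\<forall>S\<subseteq>{1..d}. signed_measure (borel_vecs S) (\<mu> S)) \<and>
     (\<forall>x\<in>vecs {1..d}. f x = c + (\<Sum>S\<in>Pow {1..d} - {{}}. \<mu> S (orthant a S x)))"

section \<open>Sections as limits at the anchor\<close>

text \<open>The orthant lies in the half-space given by its coordinate \<open>j\<close> alone, whose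
  measure is a tail of the \<open>j\<close>-th marginal. One escaping coordinate thus suffices,
  however the others move.\<close>

lemma tendsto_measure_orthant:
  assumes N: "finite_measure N" "sets N = sets (borel_vecs T)" and "finite T" "j \<in> T"
    and y: "filterlim (\<lambda>z. y z j) (if a j = \<infinity> then at_top else at_bot) F"
  shows "((\<lambda>z. measure N (orthant a T (y z))) \<longlongrightarrow> 0) F"
proof -
  interpret finite_measure N by (rule N)
  have space_N: "space N = vecs T"
    using sets_eq_imp_space_eq[OF N(2)] by (simp add: space_borel_vecs)
  have mj [measurable]: "(\<lambda>w. w j) \<in> borel_measurable N"
    unfolding measurable_cong_sets[OF N(2) refl] using assms by measurable
  define G where "G = distr N borel (\<lambda>w. w j)"
  interpret G: finite_borel_measure G
    by (intro finite_borel_measure.intro finite_borel_measure_axioms.intro)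
      (auto simp: G_def intro!: finite_measure_distr)
  define h where "h t = measure G (if a j = \<infinity> then {t<..} else {..t})" for t
  have "(h \<longlongrightarrow> 0) (if a j = \<infinity> then at_top else at_bot)"
  proof (cases "a j = \<infinity>")
    case True
    have "h = (\<lambda>t. measure G (space G) - cdf G t)"
    proof
      fix t
      have "measure G (space G - {..t}) = measure G (space G) - measure G {..t}"
        by (intro G.finite_measure_Diff) (auto simp: G_def)
      moreover have "space G - {..t} = {t<..}" by (auto simp: G_def)
      ultimately show "h t = measure G (space G) - cdf G t" using True by (simp add: h_def cdf_def)
    qed
    moreover have "((\<lambda>t. measure G (space G) - cdf G t) \<longlongrightarrow> measure G (space G) - measure G (space G)) at_top"
      by (intro tendsto_intros G.cdf_lim_at_top)
    ultimately show ?thesis using True by simp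
  next
    case False
    then have "h = cdf G" by (auto simp: h_def cdf_def)
    then show ?thesis using False G.cdf_lim_at_bot by simp
  qed
  then have lim: "((\<lambda>z. h (y z j)) \<longlongrightarrow> 0) F"
    using y by (rule filterlim_compose)
  have "measure N (orthant a T (y z)) \<le> h (y z j)" for z
  proof -
    have "h (y z j) = measure N ((\<lambda>w. w j) -` (if a j = \<infinity> then {y z j<..} else {..y z j}) \<inter> space N)"
      unfolding h_def G_def by (subst measure_distr) auto
    moreover have "orthant a T (y z) \<subseteq> (\<lambda>w. w j) -` (if a j = \<infinity> then {y z j<..} else {..y z j}) \<inter> space N"
    proof
      fix w assume "w \<in> orthant a T (y z)"
      then have "w j \<in> (if a j = \<infinity> then {y z j<..} else {..y z j})" "w \<in> vecs T"
        using assms(4) unfolding orthant_def by (auto simp: PiE_iff split del: if_split)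
      then show "w \<in> (\<lambda>w. w j) -` (if a j = \<infinity> then {y z j<..} else {..y z j}) \<inter> space N"
        by (simp add: space_N)
    qed
    ultimately show ?thesis
      by (auto intro!: finite_measure_mono measurable_sets[OF mj])
  qed
  then show ?thesis
    by (intro tendsto_sandwich[OF _ _ tendsto_const lim]) auto
qed

text \<open>Needed for \<open>Lim\<close> to be determined by convergence. The ray whose coordinates
  are t or -t according to the anchor converges along the filter as t tends to infinity.\<close>

lemma to_anchor_nontrivial: "to_anchor T a \<noteq> bot"
proof -
  have "filtermap (\<lambda>t j. if a j = \<infinity> then t else - t) at_top \<le> to_anchor T a"
    unfolding to_anchor_def
  proof (rule INF_greatest)
    fix j assume "j \<in> T"
    have "filterlim (\<lambda>t::real. if a j = \<infinity> then t else - t) (if a j = \<infinity> then at_top else at_bot) at_top"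
    proof (cases "a j = \<infinity>")
      case True
      then show ?thesis by (simp add: filterlim_ident)
    next
      case False
      then show ?thesis using filterlim_uminus_at_bot_at_top by (simp only: if_False)
    qed
    then show "filtermap (\<lambda>t j. if a j = \<infinity> then t else - t) at_top
        \<le> filtercomap (\<lambda>y :: nat \<Rightarrow> real. y j) (if a j = \<infinity> then at_top else at_bot)"
      unfolding filtermap_le_iff_le_filtercomap[symmetric] filtermap_filtermap filterlim_def .
  qed
  moreover have "filtermap (\<lambda>t j. if a j = \<infinity> then t else - t :: real) at_top \<noteq> bot"
    by (simp add: filtermap_bot_iff)
  ultimately show ?thesis by (metis bot.extremum_uniqueI)
qed

lemma filterlim_to_anchor:
  "j \<in> T \<Longrightarrow> filterlim (\<lambda>y. y j) (if a j = \<infinity> then at_top else at_bot) (to_anchor T a)"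
  unfolding filterlim_iff_le_filtercomap to_anchor_def by (rule INF_lower)

text \<open>A term with \<open>T\<close> inside \<open>S\<close> does not see the coordinates sent
  to the anchor. Any other \<open>T\<close> contains such a coordinate, and both Jordan parts of its
  term tend to 0.\<close>

lemma anchored_section_canonical:
  assumes f: "canonical_rep d a c \<mu> f" and S: "S \<subseteq> {1..d}"
  shows "anchored_section d S a f x = c + (\<Sum>T\<in>Pow S - {{}}. \<mu> T (orthant a T x))"
proof -
  let ?F = "to_anchor ({1..d} - S) a" and ?m = "\<lambda>y. merge S ({1..d} - S) (x, y)"
  have lim: "((\<lambda>y. \<mu> T (orthant a T (?m y))) \<longlongrightarrow> (if T \<subseteq> S then \<mu> T (orthant a T x) else 0)) ?F"
    if T: "T \<subseteq> {1..d}" for T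
  proof (cases "T \<subseteq> S")
    case True
    then have "orthant a T (?m y) = orthant a T x" for y
      by (intro orthant_cong) (auto simp: merge_def)
    then show ?thesis using True by simp
  next
    case False
    then obtain j where j: "j \<in> T" "j \<notin> S" by blast
    have \<mu>: "signed_measure (borel_vecs T) (\<mu> T)" using f T by (simp add: canonical_rep_def)
    have fin: "finite T" using T by (rule finite_subset) simp
    have "filterlim (\<lambda>y. ?m y j) (if a j = \<infinity> then at_top else at_bot) ?F"
      using filterlim_to_anchor[of j "{1..d} - S" a] j T by (auto simp: merge_def)
    note lim = tendsto_measure_orthant[where y = ?m and a = a, OF _ _ fin j(1) this]
    have "((\<lambda>y. measure (pos_part (borel_vecs T) (\<mu> T)) (orthant a T (?m y)) -
        measure (neg_part (borel_vecs T) (\<mu> T)) (orthant a T (?m y))) \<longlongrightarrow> 0 - 0) ?F"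
      using \<mu> by (intro tendsto_diff lim finite_measure_pos_part finite_measure_neg_part) auto
    then show ?thesis
      using False by (simp add: signed_measure_jordan[OF \<mu> orthant_sets[OF fin]])
  qed
  have "((\<lambda>y. c + (\<Sum>T\<in>Pow {1..d} - {{}}. \<mu> T (orthant a T (?m y)))) \<longlongrightarrow>
      c + (\<Sum>T\<in>Pow {1..d} - {{}}. if T \<subseteq> S then \<mu> T (orthant a T x) else 0)) ?F"
    by (intro tendsto_add tendsto_const tendsto_sum lim) auto
  moreover have "(\<Sum>T\<in>Pow {1..d} - {{}}. if T \<subseteq> S then \<mu> T (orthant a T x) else 0) =
      (\<Sum>T\<in>Pow S - {{}}. \<mu> T (orthant a T x))"
    using S by (intro sum.mono_neutral_cong_right) auto
  moreover have "c + (\<Sum>T\<in>Pow {1..d} - {{}}. \<mu> T (orthant a T (?m y))) = f (?m y)" for y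
  proof -
    have "?m y \<in> vecs {1..d}" using S by (auto simp: merge_def PiE_iff extensional_def)
    then show ?thesis using f by (simp add: canonical_rep_def)
  qed
  ultimately have "((\<lambda>y. f (?m y)) \<longlongrightarrow> c + (\<Sum>T\<in>Pow S - {{}}. \<mu> T (orthant a T x))) ?F"
    by simp
  then show ?thesis
    unfolding anchored_section_def by (intro tendsto_Lim to_anchor_nontrivial)
qed

section \<open>Quasi-volumes as measures of half-open boxes\<close>

lemma sum_PiE_01:
  fixes h :: "nat \<Rightarrow> nat \<Rightarrow> real"
  assumes "finite S"
  shows "(\<Sum>\<delta>\<in>PiE S (\<lambda>_. {0, 1 :: nat}). (- 1) ^ (\<Sum>j\<in>S. \<delta> j) * (\<Prod>j\<in>S. h j (\<delta> j))) =
    (\<Prod>j\<in>S. h j 0 - h j 1)"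
proof -
  have "(\<Prod>j\<in>S. h j 0 - h j 1) = (\<Prod>j\<in>S. \<Sum>b\<in>{0, 1 :: nat}. (- 1) ^ b * h j b)"
    by simp
  also have "\<dots> = (\<Sum>\<delta>\<in>PiE S (\<lambda>_. {0, 1}). \<Prod>j\<in>S. (- 1) ^ \<delta> j * h j (\<delta> j))"
    using assms by (intro prod_sum_PiE) auto
  finally show ?thesis by (simp add: prod.distrib power_sum)
qed

definition corner :: "nat set \<Rightarrow> (nat \<Rightarrow> real) \<Rightarrow> (nat \<Rightarrow> real) \<Rightarrow> (nat \<Rightarrow> nat) \<Rightarrow> nat \<Rightarrow> real" where
  "corner S u v \<delta> = (\<lambda>j\<in>S. (1 - real (\<delta> j)) * v j + real (\<delta> j) * u j)"

text \<open>For a fixed threshold vector w the corner sum factorises. A coordinate of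
  \<open>S\<close> outside \<open>T\<close> contributes 1 - 1 = 0. If \<open>T = S\<close>,
  coordinate j contributes 1(w_j <= v_j) - 1(w_j <= u_j) or, at +infinity, 1(v_j < w_j) - 1(u_j <
  w_j), which is the indicator of u_j < w_j <= v_j up to sign.\<close>

lemma quasi_volume_orthant:
  assumes "finite S" "T \<subseteq> S" "\<And>j. j \<in> S \<Longrightarrow> u j < v j" and \<mu>: "signed_measure (borel_vecs T) \<mu>"
  shows "(\<Sum>\<delta>\<in>PiE S (\<lambda>_. {0, 1 :: nat}). (- 1) ^ (\<Sum>j\<in>S. \<delta> j) * \<mu> (orthant a T (corner S u v \<delta>))) =
    (if T = S then (\<Prod>j\<in>S. if a j = \<infinity> then - 1 else 1) * \<mu> (half_box S u v) else 0)"
proof -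
  have fT: "finite T" using assms finite_subset by blast
  define I where "I j t = (if a j = \<infinity> then {t<..} else {..t :: real})" for j t
  define h where "h w j b = (if j \<in> T then indicator (I j ((1 - real b) * v j + real b * u j)) (w j) else 1 :: real)"
    for w :: "nat \<Rightarrow> real" and j b
  have "(\<Sum>\<delta>\<in>PiE S (\<lambda>_. {0, 1 :: nat}). (- 1) ^ (\<Sum>j\<in>S. \<delta> j) * \<mu> (orthant a T (corner S u v \<delta>))) =
    (\<Sum>k\<in>{()}. (if T = S then (\<Prod>j\<in>S. if a j = \<infinity> then - 1 else 1) else 0) * \<mu> (half_box T u v))"
  proof (rule signed_measure_indicator_sum[OF \<mu>])
    show "finite (PiE S (\<lambda>_. {0, 1 :: nat}))" using assms by (intro finite_PiE) auto
    fix w assume "w \<in> space (borel_vecs T)"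
    then have w: "w \<in> vecs T" by (simp add: space_borel_vecs)
    have ind: "indicator (orthant a T (corner S u v \<delta>)) w = (\<Prod>j\<in>S. h w j (\<delta> j))" for \<delta>
    proof -
      have "indicator (orthant a T (corner S u v \<delta>)) w = (\<Prod>j\<in>T. h w j (\<delta> j))"
        unfolding orthant_def indicator_PiE[OF fT w]
        using assms(2) by (intro prod.cong refl) (auto simp: h_def I_def corner_def)
      also have "\<dots> = (\<Prod>j\<in>S. h w j (\<delta> j))"
        using assms by (intro prod.mono_neutral_left) (auto simp: h_def)
      finally show ?thesis .
    qed
    have "(\<Sum>\<delta>\<in>PiE S (\<lambda>_. {0, 1 :: nat}). (- 1) ^ (\<Sum>j\<in>S. \<delta> j) *
        indicator (orthant a T (corner S u v \<delta>)) w) = (\<Prod>j\<in>S. h w j 0 - h w j 1)"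
      unfolding ind by (rule sum_PiE_01[OF assms(1)])
    also have "\<dots> = (if T = S then (\<Prod>j\<in>S. if a j = \<infinity> then - 1 else 1) else 0) * indicator (half_box T u v) w"
    proof (cases "T = S")
      case True
      have "h w j 0 - h w j 1 = (if a j = \<infinity> then - 1 else 1) * indicator {u j<..v j} (w j)"
        if "j \<in> S" for j
        using True assms(3)[OF that] that by (auto simp: h_def I_def indicator_def)
      then show ?thesis
        using True unfolding half_box_def indicator_PiE[OF fT w] by (simp add: prod.distrib)
    next
      case False
      then obtain j where "j \<in> S" "j \<notin> T" using assms(2) by blast
      then have "\<exists>j\<in>S. h w j 0 - h w j 1 = 0" by (intro bexI[of _ j]) (auto simp: h_def)
      then show ?thesis using False assms(1) by simp
    qed
    finally show "(\<Sum>\<delta>\<in>PiE S (\<lambda>_. {0, 1 :: nat}). (- 1) ^ (\<Sum>j\<in>S. \<delta> j) *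
        indicator (orthant a T (corner S u v \<delta>)) w :: real) = (\<Sum>k\<in>{()}.
          (if T = S then (\<Prod>j\<in>S. if a j = \<infinity> then - 1 else 1) else 0) * indicator (half_box T u v) w)"
      by simp
  qed (use fT in auto)
  then show ?thesis by auto
qed

lemma quasi_volume_canonical:
  assumes S: "finite S" "S \<noteq> {}" and uv: "\<And>j. j \<in> S \<Longrightarrow> u j < v j"
    and \<mu>: "\<And>T. T \<subseteq> S \<Longrightarrow> signed_measure (borel_vecs T) (\<mu> T)"
    and g: "\<And>x. g x = c + (\<Sum>T\<in>Pow S - {{}}. \<mu> T (orthant a T x))"
  shows "\<bar>quasi_volume S g (u, v)\<bar> = \<bar>\<mu> S (half_box S u v)\<bar>"
proof -
  let ?D = "PiE S (\<lambda>_. {0, 1 :: nat})" and ?s = "\<lambda>\<delta>. (- 1 :: real) ^ (\<Sum>j\<in>S. \<delta> j)"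
  \<comment> \<open>As \<open>S\<close> is nonempty, the signs of the corners sum to 0 and the
    constant \<open>c\<close> drops out.\<close>
  have "(\<Sum>\<delta>\<in>?D. ?s \<delta>) = 0"
    using sum_PiE_01[OF S(1), of "\<lambda>_ _. 1"] S by (auto simp: card_eq_0_iff)
  then have c0: "(\<Sum>\<delta>\<in>?D. ?s \<delta> * c) = 0" by (simp add: sum_distrib_right[symmetric])
  have "quasi_volume S g (u, v) = (\<Sum>\<delta>\<in>?D. ?s \<delta> * g (corner S u v \<delta>))"
    by (simp add: quasi_volume_def corner_def)
  also have "\<dots> = (\<Sum>\<delta>\<in>?D. ?s \<delta> * c) +
      (\<Sum>\<delta>\<in>?D. \<Sum>T\<in>Pow S - {{}}. ?s \<delta> * \<mu> T (orthant a T (corner S u v \<delta>)))"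
    by (simp add: g distrib_left sum.distrib sum_distrib_left)
  also have "\<dots> = (\<Sum>T\<in>Pow S - {{}}. \<Sum>\<delta>\<in>?D. ?s \<delta> * \<mu> T (orthant a T (corner S u v \<delta>)))"
    unfolding c0 add_0_left by (rule sum.swap)
  also have "\<dots> = (\<Sum>T\<in>Pow S - {{}}. if T = S then (\<Prod>j\<in>S. if a j = \<infinity> then - 1 else 1) * \<mu> S (half_box S u v) else 0)"
  proof (rule sum.cong[OF refl])
    fix T assume "T \<in> Pow S - {{}}"
    then show "(\<Sum>\<delta>\<in>?D. ?s \<delta> * \<mu> T (orthant a T (corner S u v \<delta>))) =
        (if T = S then (\<Prod>j\<in>S. if a j = \<infinity> then - 1 else 1) * \<mu> S (half_box S u v) else 0)"
      using uv \<mu> by (subst quasi_volume_orthant[OF S(1)]) auto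
  qed
  also have "\<dots> = (\<Prod>j\<in>S. if a j = \<infinity> then - 1 else 1) * \<mu> S (half_box S u v)"
    using S by (simp add: sum.delta')
  finally have "\<bar>quasi_volume S g (u, v)\<bar> = (\<Prod>j\<in>S. \<bar>if a j = \<infinity> then - 1 else 1 :: real\<bar>) * \<bar>\<mu> S (half_box S u v)\<bar>"
    by (simp add: abs_mult abs_prod)
  also have "(\<Prod>j\<in>S. \<bar>if a j = \<infinity> then - 1 else 1 :: real\<bar>) = 1"
    by (intro prod.neutral) auto
  finally show ?thesis by simp
qed

section \<open>The Vitali variation as a total variation norm\<close>

lemma Vit_le_tv_norm:
  assumes "finite S" and \<mu>: "signed_measure (borel_vecs S) \<mu>"
    and qv: "\<And>u v. \<forall>j\<in>S. u j < v j \<Longrightarrow> \<bar>quasi_volume S g (u, v)\<bar> = \<bar>\<mu> (half_box S u v)\<bar>"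
  shows "Vit S g \<le> tv_norm (borel_vecs S) \<mu>"
proof -
  let ?Q = "var_measure (borel_vecs S) \<mu>"
  interpret Q: finite_measure ?Q by (rule finite_measure_var_measure) fact
  have "(\<Sum>R\<in>P. ennreal \<bar>quasi_volume S g R\<bar>) \<le> tv_norm (borel_vecs S) \<mu>"
    if P: "P \<in> axis_aligned_splits S a b" for P a b
  proof -
    note cells = split_cells[OF assms(1) P]
    let ?hb = "\<lambda>R. half_box S (fst R) (snd R)"
    have hb: "?hb R \<in> sets (borel_vecs S)" for R using assms(1) by measurable
    have "(\<Sum>R\<in>P. ennreal \<bar>quasi_volume S g R\<bar>) \<le> (\<Sum>R\<in>P. emeasure ?Q (?hb R))"
    proof (rule sum_mono)
      fix R assume "R \<in> P"
      then have "\<bar>quasi_volume S g R\<bar> = \<bar>\<mu> (?hb R)\<bar>"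
        using qv[of "fst R" "snd R"] cells(2) by simp
      also have "\<dots> \<le> measure ?Q (?hb R)" by (rule signed_measure_abs_le[OF \<mu> hb])
      finally show "ennreal \<bar>quasi_volume S g R\<bar> \<le> emeasure ?Q (?hb R)"
        by (simp add: Q.emeasure_eq_measure ennreal_leI)
    qed
    also have "\<dots> = emeasure ?Q (\<Union>R\<in>P. ?hb R)"
    proof (rule sum_emeasure)
      show "disjoint_family_on ?hb P"
        unfolding disjoint_family_on_def
      proof (intro ballI impI, rule ccontr)
        fix R R' assume R: "R \<in> P" "R' \<in> P" "R \<noteq> R'" "?hb R \<inter> ?hb R' \<noteq> {}"
        then obtain w where w: "w \<in> ?hb R" "w \<in> ?hb R'" by blast
        then have "w \<in> vecs S" by (auto simp: half_box_def PiE_iff)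
        then show False using cells(3) R w by blast
      qed
    qed (use cells(1) hb in auto)
    also have "\<dots> \<le> emeasure ?Q (space ?Q)" by (rule emeasure_space)
    also have "\<dots> = tv_norm (borel_vecs S) \<mu>" by (simp add: emeasure_var_measure_space)
    finally show ?thesis .
  qed
  then show ?thesis
    unfolding Vit_def Vit_on_def by (auto intro!: SUP_least)
qed

lemma sorted_list_split:
  assumes "finite S" "finite C" "r > 0" "C \<subseteq> {-r<..<r}"
  shows "\<exists>P\<in>axis_aligned_splits S (\<lambda>j\<in>S. - r) (\<lambda>j\<in>S. r).
    \<forall>R\<in>P. \<forall>j\<in>S. \<forall>c\<in>C. c \<le> fst R j \<or> snd R j \<le> c"
proof -
  define X where "X = C \<union> {-r, r}"
  define xs where "xs = sorted_list_of_set X"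
  have X: "finite X" using assms by (simp add: X_def)
  have set_xs: "set xs = X" and srt: "sorted_wrt (<) xs"
    using X by (simp_all add: xs_def)
  define n where "n = length xs - 1"
  have "card X \<ge> card {-r, r}" using X by (intro card_mono) (auto simp: X_def)
  then have len: "length xs = n + 1" "n \<ge> 1"
    using assms(3) by (auto simp: n_def xs_def)
  have nth_less: "xs ! i < xs ! k" if "i < k" "k < length xs" for i k
    using srt that by (simp add: sorted_wrt_nth_less)
  have lo: "xs ! 0 = - r"
  proof -
    have "- r \<in> set xs" by (simp add: set_xs X_def)
    then obtain i where i: "i < length xs" "xs ! i = - r" by (auto simp: in_set_conv_nth)
    have "xs ! 0 \<ge> - r" using set_xs len assms nth_mem[of 0 xs] by (auto simp: X_def)
    then show ?thesis using nth_less[of 0 i] i by (cases "i = 0") auto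
  qed
  have hi: "xs ! n = r"
  proof -
    have "r \<in> set xs" by (simp add: set_xs X_def)
    then obtain i where i: "i < length xs" "xs ! i = r" by (auto simp: in_set_conv_nth)
    have "xs ! n \<le> r" using set_xs len assms nth_mem[of n xs] by (auto simp: X_def)
    then show ?thesis using nth_less[of i n] i len by (cases "i = n") auto
  qed
  \<comment> \<open>Partition points are counted from 1 but list entries from 0, hence
    \<open>k - 1\<close>. All coordinates use the same cut points.\<close>
  define u where "u = (\<lambda>(j::nat) k. xs ! (k - 1))"
  define P where "P = (\<lambda>l. (\<lambda>j\<in>S. u j (l j), \<lambda>j\<in>S. u j (l j + 1))) ` PiE S (\<lambda>j. {1..n})"
  have "P \<in> axis_aligned_splits S (\<lambda>j\<in>S. - r) (\<lambda>j\<in>S. r)"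
    unfolding axis_aligned_splits_def P_def mem_Collect_eq
    using lo hi len nth_less by (intro exI[of _ "\<lambda>_. n"] exI[of _ u]) (auto simp: u_def)
  moreover have "c \<le> fst R j \<or> snd R j \<le> c" if R: "R \<in> P" "j \<in> S" "c \<in> C" for R j c
  proof -
    obtain l where l: "l \<in> PiE S (\<lambda>j. {1..n})" "fst R j = xs ! (l j - 1)" "snd R j = xs ! (l j)"
      using R by (auto simp: P_def u_def)
    have "c \<in> set xs" using R set_xs by (simp add: X_def)
    then obtain i where i: "i < length xs" "xs ! i = c" by (auto simp: in_set_conv_nth)
    have lj: "l j \<in> {1..n}" using l R by auto
    have nth_le: "xs ! i \<le> xs ! k" if "i \<le> k" "k < length xs" for i k
      using nth_less[of i k] that by (cases "i = k") auto
    show ?thesis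
    proof (cases "i < l j")
      case True
      then have "xs ! i \<le> xs ! (l j - 1)" using lj len by (intro nth_le) auto
      then show ?thesis using i l by simp
    next
      case False
      then have "xs ! (l j) \<le> xs ! i" using i by (intro nth_le) auto
      then show ?thesis using i l by simp
    qed
  qed
  ultimately show ?thesis by blast
qed

text \<open>The norm is nearly mu(B) - mu(B^c) for a set B that almost attains the upper variation.
  B is replaced by a set E determined by cuts. In a large cube split along these cuts, each cell
  lies inside E or misses it, so the norm is nearly a signed sum of mu over cells, which the
  absolute quasi-volumes dominate.\<close>

lemma tv_norm_le_Vit:
  assumes "finite S" and \<mu>: "signed_measure (borel_vecs S) \<mu>"
    and qv: "\<And>u v. \<forall>j\<in>S. u j < v j \<Longrightarrow> \<bar>quasi_volume S g (u, v)\<bar> = \<bar>\<mu> (half_box S u v)\<bar>"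
  shows "tv_norm (borel_vecs S) \<mu> \<le> Vit S g"
proof (rule ennreal_le_epsilon)
  fix \<epsilon>' :: real assume "\<epsilon>' > 0"
  \<comment> \<open>Since p + q = 2p - mu(\<Omega>), the loss of one \<open>\<epsilon>\<close> in
    choosing \<open>B\<close> and of another in passing to \<open>E\<close> count twice each; the
    mass outside the cube costs a fifth.\<close>
  define \<epsilon> where "\<epsilon> = \<epsilon>' / 5"
  have \<epsilon>: "\<epsilon> > 0" using \<open>\<epsilon>' > 0\<close> by (simp add: \<epsilon>_def)
  let ?M = "borel_vecs S" and ?\<Omega> = "vecs S"
  let ?Q = "var_measure ?M \<mu>"
  interpret Q: finite_measure ?Q by (rule finite_measure_var_measure) fact
  note sp = space_borel_vecs[of S]
  have \<Omega>: "?\<Omega> \<in> sets ?M" using sets.top[of ?M] by (simp add: sp)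
  note abs_le = signed_measure_abs_le[OF \<mu>]
  define p where "p = enn2real (upper_variation ?M \<mu> ?\<Omega>)"
  define q where "q = enn2real (upper_variation ?M (\<lambda>A. - \<mu> A) ?\<Omega>)"
  have pq: "p \<ge> 0" "q \<ge> 0" "p - q = \<mu> ?\<Omega>" "upper_variation ?M \<mu> ?\<Omega> = ennreal p"
      "tv_norm ?M \<mu> = ennreal (p + q)"
    using upper_variation_uminus[OF \<mu> \<Omega>] upper_variation_finite[OF \<mu>]
      upper_variation_finite[OF signed_measure_uminus[OF \<mu>]]
    by (auto simp: p_def q_def tv_norm_eq[OF \<mu>] sp)
  obtain B where B: "B \<in> sets ?M" "\<mu> B > p - \<epsilon>"
  proof -
    have "\<exists>B\<in>{B \<in> sets ?M. B \<subseteq> ?\<Omega>}. ennreal p < ennreal (\<mu> B) + ennreal \<epsilon>"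
      using \<epsilon> pq(4) unfolding upper_variation_def by (intro SUP_approx_ennreal) auto
    then obtain B where B: "B \<in> sets ?M" "ennreal p < ennreal (max 0 (\<mu> B)) + ennreal \<epsilon>"
      by (auto simp: ennreal_max_0)
    then have "p < max 0 (\<mu> B) + \<epsilon>"
      using \<epsilon> pq(1) by (simp add: ennreal_plus[symmetric] ennreal_less_iff del: ennreal_plus)
    \<comment> \<open>If \<open>\<mu> B\<close> is negative, then \<open>p < \<epsilon>\<close> and
      the empty set serves as well.\<close>
    then show thesis
      using that[of B] that[of "{}"] B(1) signed_measure_empty[OF \<mu>]
      by (cases "\<mu> B \<ge> 0") auto
  qed
  obtain C E where CE: "finite C" "cut_determined S C E" "E \<in> sets ?M" "measure ?Q (sym_diff B E) < \<epsilon>"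
    using cut_approx_borel[OF Q.finite_measure_axioms, of S B] \<epsilon> B(1) by (auto simp: cut_approx_def)
  have BE: "\<mu> B \<le> \<mu> E + \<epsilon>"
  proof -
    have "\<mu> B - \<mu> E = \<mu> (B - E) - \<mu> (E - B)"
      by (rule signed_measure_sub_eq[OF \<mu> B(1) CE(3)])
    moreover have "measure ?Q (B - E) + measure ?Q (E - B) = measure ?Q (sym_diff B E)"
      using B(1) CE(3) by (intro Q.finite_measure_Union[symmetric]) auto
    ultimately show ?thesis
      using abs_le[of "B - E"] abs_le[of "E - B"] B(1) CE(3,4) by auto
  qed
  define bb where "bb r = half_box S (\<lambda>j\<in>S. - r) (\<lambda>j\<in>S. r)" for r
  have bb: "bb r \<in> sets ?M" for r using assms(1) by (simp add: bb_def half_box_sets)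
  have "(\<lambda>n. measure ?Q (bb (real n))) \<longlonglongrightarrow> measure ?Q (\<Union>n. bb (real n))"
  proof (rule Q.finite_Lim_measure_incseq)
    show "incseq (\<lambda>n. bb (real n))"
      unfolding incseq_def bb_def half_box_def by (intro allI impI PiE_mono) (auto intro: order_trans)
  qed (use bb in auto)
  moreover have "(\<Union>n. bb (real n)) = ?\<Omega>"
  proof (intro equalityI subsetI)
    fix w assume w: "w \<in> ?\<Omega>"
    obtain n :: nat where n: "n > (\<Sum>j\<in>S. \<bar>w j\<bar>)" using reals_Archimedean2 by blast
    have "\<bar>w j\<bar> < n" if "j \<in> S" for j
      using member_le_sum[of j S "\<lambda>j. \<bar>w j\<bar>"] assms(1) that n by auto
    then have "w \<in> bb (real n)" using w by (force simp: bb_def mem_half_box)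
    then show "w \<in> (\<Union>n. bb (real n))" by blast
  qed (auto simp: bb_def half_box_def PiE_iff)
  ultimately have "(\<lambda>n. measure ?Q (bb (real n))) \<longlonglongrightarrow> measure ?Q ?\<Omega>" by simp
  then have ev: "eventually (\<lambda>n. measure ?Q (bb (real n)) > measure ?Q ?\<Omega> - \<epsilon>) sequentially"
    using \<epsilon> by (intro order_tendstoD) auto
  obtain k :: nat where k: "k > (\<Sum>c\<in>C. \<bar>c\<bar>)" using reals_Archimedean2 by blast
  have "eventually (\<lambda>n. measure ?Q (bb (real n)) > measure ?Q ?\<Omega> - \<epsilon> \<and> n \<ge> k \<and> n \<ge> 1) sequentially"
    using ev eventually_ge_at_top[of k] eventually_ge_at_top[of "1::nat"] by eventually_elim auto
  then obtain n :: nat where n: "measure ?Q (bb (real n)) > measure ?Q ?\<Omega> - \<epsilon>" "n \<ge> k" "n \<ge> 1"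
    by (auto simp: eventually_sequentially)
  define r where "r = real n"
  have r: "r > 0" "measure ?Q (?\<Omega> - bb r) < \<epsilon>"
    using n Q.finite_measure_Diff[of ?\<Omega> "bb r"] \<Omega> bb[of r]
      sets.sets_into_space[OF bb[of r]] by (auto simp: r_def sp)
  have C: "C \<subseteq> {-r<..<r}"
  proof
    fix c assume "c \<in> C"
    then have "\<bar>c\<bar> < r" using member_le_sum[of c C "\<lambda>c. \<bar>c\<bar>"] CE(1) k n by (auto simp: r_def)
    then show "c \<in> {-r<..<r}" by auto
  qed
  obtain P where P: "P \<in> axis_aligned_splits S (\<lambda>j\<in>S. - r) (\<lambda>j\<in>S. r)"
    and Pc: "\<And>R j c. R \<in> P \<Longrightarrow> j \<in> S \<Longrightarrow> c \<in> C \<Longrightarrow> c \<le> fst R j \<or> snd R j \<le> c"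
    using sorted_list_split[OF assms(1) CE(1) r(1) C] by blast
  note cells = split_cells[OF assms(1) P]
  let ?hb = "\<lambda>R. half_box S (fst R) (snd R)"
  have hb: "?hb R \<in> sets ?M" for R using assms(1) by (simp add: half_box_sets)
  have hbv: "w \<in> vecs S" if "w \<in> ?hb R" for w R using that by (auto simp: half_box_def PiE_iff)
  \<comment> \<open>The sign of a cell in the approximate Hahn decomposition. Any point of the cell
    decides it, because no cut separates two points of one cell.\<close>
  define \<sigma> where "\<sigma> R = (if ?hb R \<subseteq> E then 1 else - 1 :: real)" for R
  have \<sigma>: "\<sigma> R = (if w \<in> E then 1 else - 1)" if R: "R \<in> P" "w \<in> ?hb R" for R w
  proof -
    have "w \<in> E \<longleftrightarrow> w' \<in> E" if w': "w' \<in> ?hb R" for w'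
    proof (rule cut_determinedD[OF CE(2)])
      fix j c assume "j \<in> S" "c \<in> C"
      then show "w j \<le> c \<longleftrightarrow> w' j \<le> c"
        using Pc[OF R(1), of j c] R(2) w' hbv[OF R(2)] hbv[OF w'] by (force simp: mem_half_box)
    qed (use hbv R w' in auto)
    then have "?hb R \<subseteq> E \<longleftrightarrow> w \<in> E" using R(2) by blast
    then show ?thesis by (simp add: \<sigma>_def)
  qed
  have "(\<Sum>R\<in>P. \<sigma> R * \<mu> (?hb R)) =
      (\<Sum>i\<in>{0, 1::nat}. (if i = 0 then 1 else - 1) * \<mu> (if i = 0 then E \<inter> bb r else bb r - E))"
  proof (rule signed_measure_indicator_sum[OF \<mu> cells(1)])
    fix w assume "w \<in> space ?M"
    then have w: "w \<in> ?\<Omega>" by (simp add: sp)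
    have "(\<Sum>R\<in>P. \<sigma> R * indicator (?hb R) w) =
        (if w \<in> bb r then (if w \<in> E then 1 else - 1) else 0)"
    proof (cases "w \<in> bb r")
      case True
      then obtain R where R: "R \<in> P" "w \<in> ?hb R" using cells(5) unfolding bb_def by blast
      have "(\<Sum>R'\<in>P. \<sigma> R' * indicator (?hb R') w) = (\<Sum>R'\<in>P. if R' = R then \<sigma> R else 0)"
      proof (rule sum.cong[OF refl])
        fix R' assume "R' \<in> P"
        then have "w \<in> ?hb R' \<longleftrightarrow> R' = R" using cells(3)[OF w R(1) _ R(2)] R(2) by blast
        then show "\<sigma> R' * indicator (?hb R') w = (if R' = R then \<sigma> R else 0)"
          by (auto simp: indicator_def)
      qed
      also have "\<dots> = \<sigma> R" using R cells(1) by simp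
      finally show ?thesis using True \<sigma>[OF R] by simp
    next
      case False
      then have "w \<notin> ?hb R" if "R \<in> P" for R using cells(4)[OF that] unfolding bb_def by blast
      then show ?thesis using False by simp
    qed
    then show "(\<Sum>R\<in>P. \<sigma> R * indicator (?hb R) w) = (\<Sum>i\<in>{0, 1::nat}. (if i = 0 then 1 else - 1) *
        indicator (if i = 0 then E \<inter> bb r else bb r - E) w)"
      by (auto simp: indicator_def)
  qed (use hb CE(3) bb in auto)
  then have sum_eq: "(\<Sum>R\<in>P. \<sigma> R * \<mu> (?hb R)) = \<mu> (E \<inter> bb r) - \<mu> (bb r - E)" by simp
  have E\<Omega>: "E \<subseteq> ?\<Omega>" "bb r \<subseteq> ?\<Omega>"
    using sets.sets_into_space[OF CE(3)] sets.sets_into_space[OF bb[of r]] by (auto simp: sp)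
  \<comment> \<open>The losses are \<open>E - bb r\<close> and \<open>?\<Omega> - bb r - E\<close>.
    They are disjoint subsets of the complement of the cube, so together they cost less than one
    \<open>\<epsilon>\<close>.\<close>
  have "\<mu> (E \<inter> bb r) - \<mu> (bb r - E) \<ge> 2 * \<mu> E - \<mu> ?\<Omega> - \<epsilon>"
  proof -
    have e1: "\<mu> E = \<mu> (E \<inter> bb r) + \<mu> (E - bb r)"
      using signed_measure_Un[OF \<mu>, of "E \<inter> bb r" "E - bb r"] CE(3) bb[of r]
      by (simp add: Int_Diff_Un Int_Diff_disjoint)
    have e2: "\<mu> (?\<Omega> - E) = \<mu> ?\<Omega> - \<mu> E"
      using signed_measure_Diff[OF \<mu> \<Omega> CE(3) E\<Omega>(1)] .
    have "(bb r - E) \<union> (?\<Omega> - bb r - E) = ?\<Omega> - E" using E\<Omega> by auto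
    then have e3: "\<mu> (?\<Omega> - E) = \<mu> (bb r - E) + \<mu> (?\<Omega> - bb r - E)"
      using signed_measure_Un[OF \<mu>, of "bb r - E" "?\<Omega> - bb r - E"] CE(3) bb[of r] \<Omega> by auto
    have "measure ?Q (E - bb r) + measure ?Q (?\<Omega> - bb r - E) = measure ?Q ((E - bb r) \<union> (?\<Omega> - bb r - E))"
      using CE(3) bb[of r] \<Omega> by (intro Q.finite_measure_Union[symmetric]) auto
    also have "\<dots> \<le> measure ?Q (?\<Omega> - bb r)"
      using CE(3) bb[of r] \<Omega> E\<Omega> by (intro Q.finite_measure_mono) auto
    finally show ?thesis
      using e1 e2 e3 abs_le[of "E - bb r"] abs_le[of "?\<Omega> - bb r - E"] CE(3) bb[of r] \<Omega> r(2) by auto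
  qed
  then have "p + q \<le> (\<Sum>R\<in>P. \<sigma> R * \<mu> (?hb R)) + \<epsilon>'"
    using sum_eq BE B(2) pq(3) by (simp add: \<epsilon>_def)
  also have "(\<Sum>R\<in>P. \<sigma> R * \<mu> (?hb R)) \<le> (\<Sum>R\<in>P. \<bar>quasi_volume S g R\<bar>)"
  proof (rule sum_mono)
    fix R assume "R \<in> P"
    then have "\<bar>quasi_volume S g R\<bar> = \<bar>\<mu> (?hb R)\<bar>"
      using qv[of "fst R" "snd R"] cells(2) by simp
    then show "\<sigma> R * \<mu> (?hb R) \<le> \<bar>quasi_volume S g R\<bar>" by (auto simp: \<sigma>_def)
  qed
  finally have "tv_norm ?M \<mu> \<le> ennreal ((\<Sum>R\<in>P. \<bar>quasi_volume S g R\<bar>) + \<epsilon>')"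
    unfolding pq(5) by (intro ennreal_leI) simp
  also have "\<dots> = (\<Sum>R\<in>P. ennreal \<bar>quasi_volume S g R\<bar>) + ennreal \<epsilon>'"
    using \<open>\<epsilon>' > 0\<close> by (simp add: sum_nonneg)
  also have "(\<Sum>R\<in>P. ennreal \<bar>quasi_volume S g R\<bar>) \<le> Vit_on S g (\<lambda>j\<in>S. - r) (\<lambda>j\<in>S. r)"
    unfolding Vit_on_def by (rule SUP_upper[OF P])
  also have "\<dots> \<le> Vit S g"
    unfolding Vit_def using r(1) by (intro SUP_upper2[of "(\<lambda>j\<in>S. - r, \<lambda>j\<in>S. r)"]) auto
  finally show "tv_norm ?M \<mu> \<le> Vit S g + ennreal \<epsilon>'" by simp
qed

text \<open>An equality, used in both directions: HK is bounded through the norms of a family built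
  from a given representation, and conversely such norms are replaced by HK to bound
  \<open>V_XGB\<close>.\<close>

lemma HK_canonical:
  assumes f: "canonical_rep d a c \<mu> f"
  shows "HK d a f = (\<Sum>S\<in>Pow {1..d} - {{}}. tv_norm (borel_vecs S) (\<mu> S))"
  unfolding HK_def
proof (rule sum.cong[OF refl])
  fix S assume "S \<in> Pow {1..d} - {{}}"
  then have S: "S \<subseteq> {1..d}" "S \<noteq> {}" by auto
  have fin: "finite S" using S(1) by (rule finite_subset) simp
  have \<mu>: "signed_measure (borel_vecs T) (\<mu> T)" if "T \<subseteq> S" for T
    using f S that by (auto simp: canonical_rep_def)
  have "\<bar>quasi_volume S (anchored_section d S a f) (u, v)\<bar> = \<bar>\<mu> S (half_box S u v)\<bar>"
    if "\<forall>j\<in>S. u j < v j" for u v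
  proof (rule quasi_volume_canonical[OF fin S(2)])
    show "anchored_section d S a f x = c + (\<Sum>T\<in>Pow S - {{}}. \<mu> T (orthant a T x))" for x
      by (rule anchored_section_canonical[OF f S(1)])
  qed (use that \<mu> in auto)
  then show "Vit S (anchored_section d S a f) = tv_norm (borel_vecs S) (\<mu> S)"
    using fin \<mu> by (intro antisym Vit_le_tv_norm tv_norm_le_Vit) auto
qed

section \<open>Expansion of basis functions at an anchor\<close>

text \<open>As with \<open>orthant\<close>, the point x is fixed and the parameters vary: the signed
  integral of a basis function at x is the signed measure of this set.\<close>

definition basis_set :: "nat set \<Rightarrow> nat set \<Rightarrow> (nat \<Rightarrow> real) \<Rightarrow> ((nat \<Rightarrow> real) \<times> (nat \<Rightarrow> real)) set" where
  "basis_set L U x = PiE L (\<lambda>j. {..x j}) \<times> PiE U (\<lambda>j. {x j<..})"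

lemma space_param_space: "space (param_space (L, U)) = vecs L \<times> vecs U"
  by (simp add: param_space_def space_pair_measure space_PiM)

lemma basis_set_sets:
  "finite L \<Longrightarrow> finite U \<Longrightarrow> basis_set L U x \<in> sets (param_space (L, U))"
  unfolding basis_set_def param_space_def by (auto intro!: pair_measureI sets_PiM_I_finite)

lemma basis_fun_eq_indicator:
  assumes "finite L" "finite U" "l \<in> vecs L" "u \<in> vecs U"
  shows "basis_fun L U l u x = indicator (basis_set L U x) (l, u)"
  by (simp only: basis_fun_def basis_set_def indicator_times fst_conv snd_conv
      indicator_PiE[OF assms(1,3)] indicator_PiE[OF assms(2,4)]) (simp add: indicator_def of_bool_def)

lemma finite_index_pairs: "finite (index_pairs d s)"
  by (rule finite_subset[of _ "Pow {1..d} \<times> Pow {1..d}"]) (auto simp: index_pairs_def)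

lemma index_pairsD:
  assumes "(L, U) \<in> index_pairs d s"
  shows "L \<subseteq> {1..d}" "U \<subseteq> {1..d}" "finite L" "finite U" "card L + card U \<le> s"
  using assms by (auto simp: index_pairs_def intro: finite_subset)

lemma st_fun_eq:
  assumes "\<forall>p\<in>index_pairs d s. signed_measure (param_space p) (\<nu> p)"
  shows "st_fun d s c \<nu> x = c + (\<Sum>p\<in>index_pairs d s. \<nu> p (basis_set (fst p) (snd p) x))"
proof -
  have "signed_integral (param_space p) (\<nu> p) (\<lambda>(l, u). basis_fun (fst p) (snd p) l u x) =
      \<nu> p (basis_set (fst p) (snd p) x)" if p: "p \<in> index_pairs d s" for p
  proof -
    obtain L U where LU: "p = (L, U)" by force
    note fin = index_pairsD[OF p[unfolded LU]]
    show ?thesis unfolding LU fst_conv snd_conv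
    proof (rule signed_integral_indicator)
      show "signed_measure (param_space (L, U)) (\<nu> (L, U))" using assms p LU by blast
    qed (use fin basis_set_sets in \<open>auto simp: space_param_space basis_fun_eq_indicator\<close>)
  qed
  then show ?thesis unfolding st_fun_def by (auto simp: case_prod_unfold intro!: sum.cong)
qed

text \<open>
  A factor of a basis function is expanded into threshold indicators vanishing at the anchor.
  Choice \<open>0\<close> stands for the constant \<open>1\<close>, choice \<open>1\<close> for the threshold \<open>l j\<close> and choice \<open>2\<close> for
  the threshold \<open>u j\<close>; the signs are those of \<open>1(x \<ge> l) = 1 - 1(x < l)\<close>, of
  \<open>1(x < u) = 1 - 1(x \<ge> u)\<close> and, for \<open>l < u\<close>, of
  \<open>1(l \<le> x < u) = 1(x \<ge> l) - 1(x \<ge> u) = 1(x < u) - 1(x < l)\<close>.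
\<close>

definition choices :: "(nat \<Rightarrow> ereal) \<Rightarrow> nat set \<Rightarrow> nat set \<Rightarrow> nat \<Rightarrow> nat set" where
  "choices a L U j = (if j \<in> L \<inter> U then {1, 2}
     else if j \<in> L then (if a j = \<infinity> then {0, 1} else {1})
     else (if a j = \<infinity> then {2} else {0, 2}))"

definition choice_sign :: "(nat \<Rightarrow> ereal) \<Rightarrow> nat \<Rightarrow> nat \<Rightarrow> real" where
  "choice_sign a j k = (if k \<noteq> 0 \<and> (k = 1 \<longleftrightarrow> a j = \<infinity>) then - 1 else 1)"

definition choice_funs :: "(nat \<Rightarrow> ereal) \<Rightarrow> nat set \<times> nat set \<Rightarrow> (nat \<Rightarrow> nat) set" where
  "choice_funs a = (\<lambda>(L, U). PiE (L \<union> U) (choices a L U))"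

definition choice_supp :: "nat set \<times> nat set \<Rightarrow> (nat \<Rightarrow> nat) \<Rightarrow> nat set" where
  "choice_supp = (\<lambda>(L, U) \<sigma>. {j \<in> L \<union> U. \<sigma> j \<noteq> 0})"

definition choice_sgn :: "(nat \<Rightarrow> ereal) \<Rightarrow> nat set \<times> nat set \<Rightarrow> (nat \<Rightarrow> nat) \<Rightarrow> real" where
  "choice_sgn a = (\<lambda>(L, U) \<sigma>. \<Prod>j\<in>L \<union> U. choice_sign a j (\<sigma> j))"

text \<open>The thresholds selected by a choice, as a vector on its support; push-forwards along
  this map live on the spaces of the mu_S.\<close>

definition pick :: "nat set \<Rightarrow> (nat \<Rightarrow> nat) \<Rightarrow> (nat \<Rightarrow> real) \<times> (nat \<Rightarrow> real) \<Rightarrow> nat \<Rightarrow> real" where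
  "pick S \<sigma> = (\<lambda>(l, u). \<lambda>j\<in>S. if \<sigma> j = 1 then l j else u j)"

text \<open>If \<open>l j \<ge> u j\<close> for some overlapping coordinate, the basis function is
  identically 0, while the difference of the two thresholds need not be. Restriction to this set
  makes the expansion valid.\<close>

definition proper :: "nat set \<times> nat set \<Rightarrow> ((nat \<Rightarrow> real) \<times> (nat \<Rightarrow> real)) set" where
  "proper = (\<lambda>(L, U). {(l, u) \<in> vecs L \<times> vecs U. \<forall>j\<in>L \<inter> U. l j < u j})"

lemma proper_sets:
  assumes "finite L"
  shows "proper (L, U) \<in> sets (param_space (L, U))"
proof -
  have "{p \<in> space (param_space (L, U)). \<forall>j\<in>L \<inter> U. fst p j < snd p j} \<in> sets (param_space (L, U))"
    unfolding param_space_def prod.case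
  proof (rule sets.sets_Collect_finite_All)
    fix j assume j: "j \<in> L \<inter> U"
    then have [measurable]: "(\<lambda>p. fst p j) \<in> borel_measurable (borel_vecs L \<Otimes>\<^sub>M borel_vecs U)"
      "(\<lambda>p. snd p j) \<in> borel_measurable (borel_vecs L \<Otimes>\<^sub>M borel_vecs U)"
      by (auto intro!: measurable_compose[OF measurable_fst] measurable_compose[OF measurable_snd]
          measurable_component_singleton)
    show "{p \<in> space (borel_vecs L \<Otimes>\<^sub>M borel_vecs U). fst p j < snd p j} \<in>
        sets (borel_vecs L \<Otimes>\<^sub>M borel_vecs U)"
      by measurable
  qed (use assms in auto)
  moreover have "{p \<in> space (param_space (L, U)). \<forall>j\<in>L \<inter> U. fst p j < snd p j} = proper (L, U)"
    by (auto simp: proper_def space_param_space)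
  ultimately show ?thesis by simp
qed

lemma choice_funsD:
  assumes "\<sigma> \<in> choice_funs a (L, U)" "j \<in> choice_supp (L, U) \<sigma>"
  shows "\<sigma> j = 1 \<and> j \<in> L \<or> \<sigma> j = 2 \<and> j \<in> U"
proof -
  have "j \<in> L \<union> U" "\<sigma> j \<noteq> 0" "\<sigma> j \<in> choices a L U j"
    using assms by (auto simp: choice_funs_def choice_supp_def)
  then show ?thesis by (auto simp: choices_def split: if_splits)
qed

lemma pick_measurable:
  assumes "\<sigma> \<in> choice_funs a (L, U)" "S = choice_supp (L, U) \<sigma>"
  shows "pick S \<sigma> \<in> measurable (param_space (L, U)) (borel_vecs S)"
  unfolding pick_def param_space_def case_prod_unfold
proof (rule measurable_restrict)
  fix j assume "j \<in> S"
  then have "\<sigma> j = 1 \<and> j \<in> L \<or> \<sigma> j = 2 \<and> j \<in> U" using choice_funsD[OF assms(1)] assms(2) by blast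
  then show "(\<lambda>p. if \<sigma> j = 1 then fst p j else snd p j) \<in>
      borel_measurable (borel_vecs (fst (L, U)) \<Otimes>\<^sub>M borel_vecs (snd (L, U)))"
    by (auto intro!: measurable_compose[OF measurable_fst] measurable_compose[OF measurable_snd]
          measurable_component_singleton)
qed

lemma basis_set_expand:
  assumes fin: "finite L" "finite U" and \<nu>: "signed_measure (param_space (L, U)) \<nu>"
  shows "\<nu> (basis_set L U x) = (\<Sum>\<sigma>\<in>choice_funs a (L, U). choice_sgn a (L, U) \<sigma> *
    \<nu> (pick (choice_supp (L, U) \<sigma>) \<sigma> -` orthant a (choice_supp (L, U) \<sigma>) x \<inter> proper (L, U)))"
proof -
  let ?I = "L \<union> U" and ?S = "choice_supp (L, U)"
  let ?T = "\<lambda>\<sigma>. pick (?S \<sigma>) \<sigma> -` orthant a (?S \<sigma>) x \<inter> proper (L, U)"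
  have fS: "finite (?S \<sigma>)" for \<sigma> using fin by (simp add: choice_supp_def)
  have "(\<Sum>k\<in>{()}. 1 * \<nu> (basis_set L U x)) =
      (\<Sum>\<sigma>\<in>choice_funs a (L, U). choice_sgn a (L, U) \<sigma> * \<nu> (?T \<sigma>))"
  proof (rule signed_measure_indicator_sum[OF \<nu>])
    show "finite (choice_funs a (L, U))"
      using fin by (auto simp: choice_funs_def choices_def intro!: finite_PiE)
    show "basis_set L U x \<in> sets (param_space (L, U))" using fin by (rule basis_set_sets)
    show "?T \<sigma> \<in> sets (param_space (L, U))" if \<sigma>: "\<sigma> \<in> choice_funs a (L, U)" for \<sigma>
    proof -
      have "pick (?S \<sigma>) \<sigma> -` orthant a (?S \<sigma>) x \<inter> space (param_space (L, U)) \<inter> proper (L, U)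
          \<in> sets (param_space (L, U))"
        using proper_sets[OF fin(1)] orthant_sets[OF fS]
        by (intro sets.Int measurable_sets[OF pick_measurable[OF \<sigma> refl]])
      moreover have "proper (L, U) \<subseteq> space (param_space (L, U))"
        by (auto simp: proper_def space_param_space)
      ultimately show ?thesis by (simp add: Int_assoc Int_absorb1)
    qed
    fix p assume "p \<in> space (param_space (L, U))"
    then obtain l u where p: "p = (l, u)" "l \<in> vecs L" "u \<in> vecs U"
      by (auto simp: space_param_space)
    \<comment> \<open>\<open>K\<close> is the anchored threshold indicator and \<open>cv\<close> its
      value under a choice. The factor \<open>D\<close> is attached coordinate by coordinate so that
      its product is the indicator of \<open>proper\<close>; where it is 0, both sides of the
      coordinate identity are 0.\<close>
    define K where "K j t = (of_bool (if a j = \<infinity> then x j < t else t \<le> x j) :: real)" for j t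
    define cv where "cv j k = (if k = 0 then 1 else if k = 1 then K j (l j) else K j (u j))" for j and k :: nat
    define D where "D j = (if j \<in> L \<inter> U then of_bool (l j < u j) else 1 :: real)" for j
    have "indicator (basis_set L U x) p = basis_fun L U l u x"
      unfolding p(1) by (rule basis_fun_eq_indicator[OF fin p(2,3), symmetric])
    also have "\<dots> = (\<Prod>j\<in>?I. if j \<in> L then of_bool (l j \<le> x j) else 1) *
        (\<Prod>j\<in>?I. if j \<in> U then of_bool (x j < u j) else 1)"
      unfolding basis_fun_def using fin
      by (intro arg_cong2[where f = "(*)"] prod.mono_neutral_cong_left) auto
    also have "\<dots> = (\<Prod>j\<in>?I. (if j \<in> L then of_bool (l j \<le> x j) else 1) *
        (if j \<in> U then of_bool (x j < u j) else 1))"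
      by (rule prod.distrib[symmetric])
    also have "\<dots> = (\<Prod>j\<in>?I. \<Sum>k\<in>choices a L U j. choice_sign a j k * (cv j k * D j))"
      by (intro prod.cong refl)
        (auto simp: choices_def choice_sign_def cv_def K_def D_def of_bool_def)
    also have "\<dots> = (\<Sum>\<sigma>\<in>choice_funs a (L, U). \<Prod>j\<in>?I. choice_sign a j (\<sigma> j) * (cv j (\<sigma> j) * D j))"
      unfolding choice_funs_def prod.case using fin
      by (intro prod_sum_PiE) (auto simp: choices_def)
    also have "\<dots> = (\<Sum>\<sigma>\<in>choice_funs a (L, U). choice_sgn a (L, U) \<sigma> * indicator (?T \<sigma>) p)"
    proof (rule sum.cong[OF refl])
      fix \<sigma> assume \<sigma>: "\<sigma> \<in> choice_funs a (L, U)"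
      let ?w = "pick (?S \<sigma>) \<sigma> (l, u)"
      have w: "?w \<in> vecs (?S \<sigma>)" by (simp add: pick_def)
      have "(\<Prod>j\<in>?I. cv j (\<sigma> j)) = (\<Prod>j\<in>?S \<sigma>. cv j (\<sigma> j))"
        using fin by (intro prod.mono_neutral_right) (auto simp: choice_supp_def cv_def)
      also have "\<dots> = indicator (orthant a (?S \<sigma>) x) ?w"
        unfolding orthant_def indicator_PiE[OF fS w]
        by (intro prod.cong refl) (auto simp: cv_def K_def pick_def choice_supp_def)
      finally have 1: "(\<Prod>j\<in>?I. cv j (\<sigma> j)) = indicator (orthant a (?S \<sigma>) x) ?w" .
      have "(\<Prod>j\<in>?I. D j) = (\<Prod>j\<in>L \<inter> U. of_bool (l j < u j))"
        using fin by (intro prod.mono_neutral_cong_right) (auto simp: D_def)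
      also have "\<dots> = of_bool (\<forall>j\<in>L \<inter> U. l j < u j)"
        using fin by (induction "L \<inter> U" rule: infinite_finite_induct) auto
      finally have 2: "(\<Prod>j\<in>?I. D j) = indicator (proper (L, U)) p"
        using p by (auto simp: proper_def indicator_def)
      have "indicator (?T \<sigma>) p = indicator (orthant a (?S \<sigma>) x) ?w * (indicator (proper (L, U)) p :: real)"
        by (simp add: p(1) indicator_def)
      then show "(\<Prod>j\<in>?I. choice_sign a j (\<sigma> j) * (cv j (\<sigma> j) * D j)) =
          choice_sgn a (L, U) \<sigma> * indicator (?T \<sigma>) p"
        by (simp add: prod.distrib 1 2 choice_sgn_def)
    qed
    finally show "(\<Sum>k\<in>{()}. 1 * indicator (basis_set L U x) p) =
        (\<Sum>\<sigma>\<in>choice_funs a (L, U). choice_sgn a (L, U) \<sigma> * indicator (?T \<sigma>) p)"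
      by simp
  qed auto
  then show ?thesis by simp
qed

text \<open>Each coordinate offers at most two choices. If L and U are disjoint, at most one of them
  is nonzero and the all-zero choice is excluded, leaving 2^|L \<union> U| - 1. An overlap forbids
  choice 0 there, but it forces |L \<union> U| < s, and 2^(s-1) <= 2^s - 1.\<close>

lemma card_choice_funs:
  assumes "(L, U) \<in> index_pairs d s"
  shows "card {\<sigma> \<in> choice_funs a (L, U). choice_supp (L, U) \<sigma> \<noteq> {}} \<le> min (2 ^ s - 1) (2 ^ d)"
proof -
  note D = index_pairsD[OF assms]
  let ?I = "L \<union> U" and ?A = "{\<sigma> \<in> choice_funs a (L, U). choice_supp (L, U) \<sigma> \<noteq> {}}"
  have fin: "finite ?I" using D by simp
  have "card ?I \<le> card {1..d}" using D by (intro card_mono) auto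
  then have Id: "(2::nat) ^ card ?I \<le> 2 ^ d" by (intro power_increasing) auto
  show ?thesis
  proof (cases "L \<inter> U = {}")
    case True
    define z where "z j = (if j \<in> L then 1 else 2 :: nat)" for j
    have "?A \<subseteq> PiE ?I (\<lambda>j. {0, z j}) - {\<lambda>j\<in>?I. 0}"
    proof
      fix \<sigma> assume \<sigma>: "\<sigma> \<in> ?A"
      have "choices a L U j \<subseteq> {0, z j}" for j using True by (auto simp: choices_def z_def)
      then have "PiE ?I (choices a L U) \<subseteq> PiE ?I (\<lambda>j. {0, z j})" by (intro PiE_mono)
      moreover have "\<sigma> \<in> PiE ?I (choices a L U)" using \<sigma> by (simp add: choice_funs_def)
      ultimately have "\<sigma> \<in> PiE ?I (\<lambda>j. {0, z j})" by (rule subsetD)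
      moreover have "\<sigma> \<noteq> (\<lambda>j\<in>?I. 0)" using \<sigma> by (auto simp: choice_supp_def)
      ultimately show "\<sigma> \<in> PiE ?I (\<lambda>j. {0, z j}) - {\<lambda>j\<in>?I. 0}" by simp
    qed
    then have "card ?A \<le> card (PiE ?I (\<lambda>j. {0, z j}) - {\<lambda>j\<in>?I. 0})"
      using fin by (intro card_mono finite_Diff finite_PiE) auto
    also have "\<dots> = card (PiE ?I (\<lambda>j. {0, z j})) - 1"
      by (intro card_Diff_singleton) auto
    also have "card (PiE ?I (\<lambda>j. {0, z j})) = 2 ^ card ?I"
      using fin by (simp add: card_PiE z_def numeral_2_eq_2)
    finally have le: "card ?A \<le> 2 ^ card ?I - 1" .
    have "card ?I \<le> s" using D True by (simp add: card_Un_disjoint)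
    then have "(2::nat) ^ card ?I \<le> 2 ^ s" by (intro power_increasing) auto
    then show ?thesis using le Id by linarith
  next
    case False
    have "card ?A \<le> card (PiE ?I (choices a L U))"
      using fin by (intro card_mono finite_PiE) (auto simp: choices_def choice_funs_def)
    also have "\<dots> = (\<Prod>j\<in>?I. card (choices a L U j))" using fin by (rule card_PiE)
    also have "\<dots> \<le> (\<Prod>j\<in>?I. 2)" by (intro prod_mono) (auto simp: choices_def)
    finally have le: "card ?A \<le> 2 ^ card ?I" by simp
    have "card (L \<inter> U) > 0" using False D by (simp add: card_gt_0_iff)
    then have "card ?I + 1 \<le> s" using D card_Un_Int[of L U] by simp
    then have "(2::nat) ^ (card ?I + 1) \<le> 2 ^ s" by (intro power_increasing) auto
    moreover have "(1::nat) \<le> 2 ^ card ?I" by simp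
    ultimately have "(2::nat) ^ card ?I \<le> 2 ^ s - 1" by simp
    then show ?thesis using le Id by linarith
  qed
qed

section \<open>Passing between the two kinds of representation\<close>

text \<open>Every pair of an index and a choice yields a signed push-forward; these are collected by
  support. Empty supports merge into the constant and so stay out of the norm count. Supports lie in
  L \<union> U, hence have at most \<open>s\<close> elements, which makes the way back
  possible.\<close>

lemma canonical_rep_of_represents:
  assumes rep: "represents d s c \<nu> f"
  obtains c' \<mu> where "canonical_rep d a c' \<mu> f"
    "\<And>S B. card S > s \<Longrightarrow> \<mu> S B = 0"
    "(\<Sum>S\<in>Pow {1..d} - {{}}. tv_norm (borel_vecs S) (\<mu> S)) \<le>
      of_nat (min (2 ^ s - 1) (2 ^ d)) * (\<Sum>p\<in>index_pairs d s. tv_norm (param_space p) (\<nu> p))"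
proof -
  let ?P = "index_pairs d s"
  have \<nu>: "signed_measure (param_space p) (\<nu> p)" if "p \<in> ?P" for p
    using rep that by (auto simp: represents_def)
  define Z where "Z = (SIGMA p:?P. choice_funs a p)"
  define supp where "supp = (\<lambda>(p, \<sigma>). choice_supp p \<sigma>)"
  define m where "m = (\<lambda>S (p, \<sigma>) B. choice_sgn a p \<sigma> * \<nu> p (pick S \<sigma> -` B \<inter> proper p))"
  define \<mu> where "\<mu> S B = (\<Sum>z\<in>{z \<in> Z. supp z = S}. m S z B)" for S B
  have finC: "finite (choice_funs a p)" if "p \<in> ?P" for p
    using index_pairsD[of "fst p" "snd p" d s] that
    by (auto simp: choice_funs_def choices_def case_prod_unfold intro!: finite_PiE)
  have finZ: "finite Z" unfolding Z_def using finC finite_index_pairs by blast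
  have supp_sub: "supp ` Z \<subseteq> Pow {1..d}"
    by (auto simp: Z_def supp_def choice_supp_def index_pairs_def)
  have m: "signed_measure (borel_vecs S) (m S z)"
    "tv_norm (borel_vecs S) (m S z) \<le> tv_norm (param_space (fst z)) (\<nu> (fst z))"
    if z: "z \<in> Z" "supp z = S" for z S
  proof -
    obtain L U \<sigma> where LU: "z = ((L, U), \<sigma>)" by (metis surj_pair)
    have p: "(L, U) \<in> ?P" "\<sigma> \<in> choice_funs a (L, U)" "S = choice_supp (L, U) \<sigma>"
      using z by (auto simp: LU Z_def supp_def)
    note fin = index_pairsD[OF p(1)]
    note push = \<nu>[OF p(1)] pick_measurable[OF p(2,3)] proper_sets[OF fin(3), of U]
    have "\<bar>choice_sgn a (L, U) \<sigma>\<bar> = 1"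
      unfolding choice_sgn_def prod.case abs_prod
      by (intro prod.neutral) (auto simp: choice_sign_def)
    then have sgn: "choice_sgn a (L, U) \<sigma> = 1 \<or> choice_sgn a (L, U) \<sigma> = - 1" by linarith
    have meq: "m S z = (\<lambda>B. choice_sgn a (L, U) \<sigma> * \<nu> (L, U) (pick S \<sigma> -` B \<inter> proper (L, U)))"
      by (simp add: m_def LU)
    show "signed_measure (borel_vecs S) (m S z)"
      unfolding meq by (intro signed_measure_cmult signed_measure_push[OF push])
    show "tv_norm (borel_vecs S) (m S z) \<le> tv_norm (param_space (fst z)) (\<nu> (fst z))"
      unfolding meq tv_norm_sign[OF signed_measure_push[OF push] sgn]
      using tv_norm_push_le[OF push] by (simp add: LU)
  qed
  have \<mu>: "signed_measure (borel_vecs S) (\<mu> S)" for S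
    unfolding \<mu>_def[abs_def] using m by (intro signed_measure_sum) auto
  \<comment> \<open>The orthant over no coordinates is the same for all x; the zero vector stands in
    for x.\<close>
  define c' where "c' = c + \<mu> {} (orthant a {} (\<lambda>_. 0))"
  have "canonical_rep d a c' \<mu> f"
    unfolding canonical_rep_def
  proof (intro conjI allI impI ballI)
    show "signed_measure (borel_vecs S) (\<mu> S)" for S by (rule \<mu>)
    fix x assume "x \<in> vecs {1..d}"
    then have "f x = st_fun d s c \<nu> x" using rep by (simp add: represents_def)
    also have "\<dots> = c + (\<Sum>p\<in>?P. \<nu> p (basis_set (fst p) (snd p) x))"
      using \<nu> by (intro st_fun_eq) auto
    also have "(\<Sum>p\<in>?P. \<nu> p (basis_set (fst p) (snd p) x)) =
        (\<Sum>p\<in>?P. \<Sum>\<sigma>\<in>choice_funs a p. m (choice_supp p \<sigma>) (p, \<sigma>) (orthant a (choice_supp p \<sigma>) x))"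
    proof (rule sum.cong[OF refl])
      fix p assume p: "p \<in> ?P"
      obtain L U where LU: "p = (L, U)" by force
      show "\<nu> p (basis_set (fst p) (snd p) x) =
          (\<Sum>\<sigma>\<in>choice_funs a p. m (choice_supp p \<sigma>) (p, \<sigma>) (orthant a (choice_supp p \<sigma>) x))"
        unfolding LU fst_conv snd_conv m_def prod.case
        using p index_pairsD[of L U d s] by (intro basis_set_expand) (auto simp: LU intro: \<nu>)
    qed
    also have "\<dots> = (\<Sum>z\<in>Z. m (supp z) z (orthant a (supp z) x))"
      unfolding Z_def using finC finite_index_pairs
      by (subst sum.Sigma) (auto simp: supp_def case_prod_unfold)
    also have "\<dots> = (\<Sum>S\<in>Pow {1..d}. \<Sum>z\<in>{z \<in> Z. supp z = S}. m (supp z) z (orthant a (supp z) x))"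
      using finZ supp_sub by (intro sum.group[symmetric]) auto
    also have "\<dots> = (\<Sum>S\<in>Pow {1..d}. \<mu> S (orthant a S x))"
      by (simp add: \<mu>_def)
    also have "\<dots> = \<mu> {} (orthant a {} x) + (\<Sum>S\<in>Pow {1..d} - {{}}. \<mu> S (orthant a S x))"
      by (rule sum.remove) auto
    also have "orthant a {} x = orthant a {} (\<lambda>_. 0)" by (rule orthant_cong) simp
    finally show "f x = c' + (\<Sum>S\<in>Pow {1..d} - {{}}. \<mu> S (orthant a S x))"
      by (simp add: c'_def)
  qed
  moreover have "\<mu> S B = 0" if "card S > s" for S B
  proof -
    have "supp z \<noteq> S" if z: "z \<in> Z" for z
    proof -
      obtain L U \<sigma> where LU: "z = ((L, U), \<sigma>)" by (metis surj_pair)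
      have "(L, U) \<in> ?P" using z by (auto simp: LU Z_def)
      note D = index_pairsD[OF this]
      have "card (supp z) \<le> card (L \<union> U)"
        using D by (intro card_mono) (auto simp: LU supp_def choice_supp_def)
      also have "\<dots> \<le> s" using D(5) card_Un_le[of L U] by simp
      finally show ?thesis using \<open>card S > s\<close> by auto
    qed
    then have "{z \<in> Z. supp z = S} = {}" by blast
    then show ?thesis unfolding \<mu>_def by (simp only: sum.empty)
  qed
  moreover have "(\<Sum>S\<in>Pow {1..d} - {{}}. tv_norm (borel_vecs S) (\<mu> S)) \<le>
      of_nat (min (2 ^ s - 1) (2 ^ d)) * (\<Sum>p\<in>?P. tv_norm (param_space p) (\<nu> p))"
  proof -
    let ?t = "\<lambda>p. tv_norm (param_space p) (\<nu> p)"
    let ?Z = "{z \<in> Z. supp z \<noteq> {}}"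
    have "(\<Sum>S\<in>Pow {1..d} - {{}}. tv_norm (borel_vecs S) (\<mu> S)) \<le>
        (\<Sum>S\<in>Pow {1..d} - {{}}. \<Sum>z\<in>{z \<in> ?Z. supp z = S}. ?t (fst z))"
    proof (rule sum_mono)
      fix S assume S: "S \<in> Pow {1..d} - {{}}"
      have "tv_norm (borel_vecs S) (\<mu> S) \<le> (\<Sum>z\<in>{z \<in> Z. supp z = S}. tv_norm (borel_vecs S) (m S z))"
        unfolding \<mu>_def[abs_def] using m finZ by (intro tv_norm_sum_le) auto
      also have "\<dots> \<le> (\<Sum>z\<in>{z \<in> Z. supp z = S}. ?t (fst z))"
        using m by (intro sum_mono) auto
      also have "{z \<in> Z. supp z = S} = {z \<in> ?Z. supp z = S}" using S by auto
      finally show "tv_norm (borel_vecs S) (\<mu> S) \<le> (\<Sum>z\<in>{z \<in> ?Z. supp z = S}. ?t (fst z))" .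
    qed
    also have "\<dots> = (\<Sum>z\<in>?Z. ?t (fst z))"
      using finZ supp_sub by (intro sum.group) auto
    also have "?Z = (SIGMA p:?P. {\<sigma> \<in> choice_funs a p. choice_supp p \<sigma> \<noteq> {}})"
      by (auto simp: Z_def supp_def)
    also have "(\<Sum>z\<in>\<dots>. ?t (fst z)) = (\<Sum>p\<in>?P. \<Sum>\<sigma>\<in>{\<sigma> \<in> choice_funs a p. choice_supp p \<sigma> \<noteq> {}}. ?t p)"
      using finC finite_index_pairs by (subst sum.Sigma) (auto simp: case_prod_unfold)
    also have "\<dots> \<le> (\<Sum>p\<in>?P. of_nat (min (2 ^ s - 1) (2 ^ d)) * ?t p)"
    proof (rule sum_mono)
      fix p assume p: "p \<in> ?P"
      have "card {\<sigma> \<in> choice_funs a p. choice_supp p \<sigma> \<noteq> {}} \<le> min (2 ^ s - 1) (2 ^ d)"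
        using card_choice_funs[of "fst p" "snd p" d s a] p by simp
      then have "(of_nat (card {\<sigma> \<in> choice_funs a p. choice_supp p \<sigma> \<noteq> {}}) :: ennreal) \<le>
          of_nat (min (2 ^ s - 1) (2 ^ d))"
        by (simp only: of_nat_le_iff)
      then show "(\<Sum>\<sigma>\<in>{\<sigma> \<in> choice_funs a p. choice_supp p \<sigma> \<noteq> {}}. ?t p) \<le>
          of_nat (min (2 ^ s - 1) (2 ^ d)) * ?t p"
        by (simp only: sum_constant) (rule mult_right_mono, auto)
    qed
    finally show ?thesis by (simp only: sum_distrib_left)
  qed
  ultimately show thesis using that by blast
qed

text \<open>The product of anchored indicators over \<open>S\<close> is itself a basis function: L
  collects the coordinates anchored at -infinity, U those at +infinity. Here |L| + |U| = |S|, so the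
  vanishing assumption keeps all nonzero terms within the admissible indices.\<close>

lemma represents_of_canonical_rep:
  assumes f: "canonical_rep d a c \<mu> f" and van: "\<And>S B. card S > s \<Longrightarrow> \<mu> S B = 0"
  obtains \<nu> where "represents d s c \<nu> f"
    "(\<Sum>p\<in>index_pairs d s. tv_norm (param_space p) (\<nu> p)) \<le>
      (\<Sum>S\<in>Pow {1..d} - {{}}. tv_norm (borel_vecs S) (\<mu> S))"
proof -
  let ?P = "index_pairs d s"
  define q where "q S = ({j \<in> S. a j \<noteq> \<infinity>}, {j \<in> S. a j = \<infinity>})" for S
  define \<phi> where "\<phi> L U w = (restrict w L, restrict w U)" for L U and w :: "nat \<Rightarrow> real"
  \<comment> \<open>\<open>S\<close> is the union of the two components of \<open>q S\<close>, so
    the set belonging to a pair is read off as \<open>L \<union> U\<close>; pairs not of the form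
    \<open>q S\<close> receive the zero measure.\<close>
  define \<nu> where "\<nu> = (\<lambda>(L, U) B. if (L, U) = q (L \<union> U)
      then \<mu> (L \<union> U) (\<phi> L U -` B \<inter> vecs (L \<union> U)) else 0)"
  define X where "X = {S \<in> Pow {1..d} - {{}}. card S \<le> s}"
  have q_Un: "fst (q S) \<union> snd (q S) = S" for S by (auto simp: q_def)
  have q_inj: "inj_on q X" by (metis inj_onI q_Un)
  have q_in: "q ` X \<subseteq> ?P"
  proof
    fix p assume "p \<in> q ` X"
    then obtain S where S: "p = q S" "S \<subseteq> {1..d}" "S \<noteq> {}" "card S \<le> s" by (auto simp: X_def)
    have "finite S" using S(2) by (rule finite_subset) simp
    then have "card {j \<in> S. a j \<noteq> \<infinity>} + card {j \<in> S. a j = \<infinity>} = card S"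
      by (subst card_Un_disjoint[symmetric]) (auto intro!: arg_cong[where f = card])
    moreover have "card S > 0" using S \<open>finite S\<close> by (simp add: card_gt_0_iff)
    ultimately show "p \<in> ?P" using S by (auto simp: q_def index_pairs_def)
  qed
  have q_out: "\<nu> p = (\<lambda>B. 0)" if "p \<in> ?P - q ` X" for p
  proof -
    obtain L U where LU: "p = (L, U)" by force
    have "(L, U) \<noteq> q (L \<union> U)"
    proof
      assume eq: "(L, U) = q (L \<union> U)"
      have D: "(L, U) \<in> ?P" using that LU by simp
      have "L \<union> U \<in> X"
        using index_pairsD[OF D] D card_Un_le[of L U] by (auto simp: X_def index_pairs_def)
      then show False using eq that LU by auto
    qed
    then show ?thesis by (simp add: \<nu>_def LU)
  qed
  have sum_q: "(\<Sum>p\<in>?P. h p) = (\<Sum>S\<in>X. h (q S))"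
    if "\<And>p. p \<in> ?P - q ` X \<Longrightarrow> h p = 0" for h :: "nat set \<times> nat set \<Rightarrow> 'b::comm_monoid_add"
  proof -
    have "(\<Sum>p\<in>?P. h p) = (\<Sum>p\<in>q ` X. h p)"
      using that q_in finite_index_pairs by (intro sum.mono_neutral_right) auto
    then show ?thesis by (simp add: sum.reindex[OF q_inj])
  qed
  have \<nu>q: "\<nu> (q S) = (\<lambda>B. \<mu> S (\<phi> (fst (q S)) (snd (q S)) -` B \<inter> vecs S))" for S
  proof -
    have "q S = (fst (q S), snd (q S))" by simp
    moreover have "fst (q S) \<union> snd (q S) = S" by (rule q_Un)
    ultimately show ?thesis unfolding \<nu>_def by (simp add: case_prod_unfold)
  qed
  have \<mu>: "signed_measure (borel_vecs S) (\<mu> S)" if "S \<in> X" for S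
    using f that by (auto simp: canonical_rep_def X_def)
  have push: "\<phi> (fst (q S)) (snd (q S)) \<in> measurable (borel_vecs S) (param_space (q S))"
    "vecs S \<in> sets (borel_vecs S)" for S
  proof -
    have "\<phi> (fst (q S)) (snd (q S)) \<in> measurable (borel_vecs S) (borel_vecs (fst (q S)) \<Otimes>\<^sub>M borel_vecs (snd (q S)))"
      unfolding \<phi>_def[abs_def] by (intro measurable_Pair measurable_restrict_subset) (auto simp: q_def)
    then show "\<phi> (fst (q S)) (snd (q S)) \<in> measurable (borel_vecs S) (param_space (q S))"
      by (simp add: param_space_def case_prod_unfold)
    show "vecs S \<in> sets (borel_vecs S)" using sets.top[of "borel_vecs S"] by (simp add: space_PiM)
  qed
  have sm: "\<forall>p\<in>?P. signed_measure (param_space p) (\<nu> p)"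
  proof
    fix p assume p: "p \<in> ?P"
    show "signed_measure (param_space p) (\<nu> p)"
    proof (cases "p \<in> q ` X")
      case True
      then obtain S where S: "p = q S" "S \<in> X" by blast
      show ?thesis unfolding S(1) \<nu>q by (rule signed_measure_push[OF \<mu>[OF S(2)] push])
    next
      case False
      then show ?thesis using p by (simp add: q_out signed_measure_zero)
    qed
  qed
  have "represents d s c \<nu> f"
    unfolding represents_def
  proof (intro conjI sm ballI)
    fix x assume x: "x \<in> vecs {1..d}"
    have "st_fun d s c \<nu> x = c + (\<Sum>p\<in>?P. \<nu> p (basis_set (fst p) (snd p) x))"
      by (rule st_fun_eq[OF sm])
    also have "(\<Sum>p\<in>?P. \<nu> p (basis_set (fst p) (snd p) x)) =
        (\<Sum>S\<in>X. \<nu> (q S) (basis_set (fst (q S)) (snd (q S)) x))"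
      by (rule sum_q) (simp add: q_out)
    also have "\<dots> = (\<Sum>S\<in>X. \<mu> S (orthant a S x))"
    proof (intro sum.cong refl)
      fix S assume "S \<in> X"
      have "\<phi> (fst (q S)) (snd (q S)) -` basis_set (fst (q S)) (snd (q S)) x \<inter> vecs S = orthant a S x"
        using mem_orthant[of _ S a x] orthant_subset[of a S x]
        by (auto simp: \<phi>_def basis_set_def q_def PiE_iff)
      then show "\<nu> (q S) (basis_set (fst (q S)) (snd (q S)) x) = \<mu> S (orthant a S x)"
        by (simp add: \<nu>q)
    qed
    also have "\<dots> = (\<Sum>S\<in>Pow {1..d} - {{}}. \<mu> S (orthant a S x))"
      unfolding X_def using van by (intro sum.mono_neutral_left) (auto, metis not_le)
    finally show "st_fun d s c \<nu> x = f x" using f x by (simp add: canonical_rep_def)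
  qed
  moreover have "(\<Sum>p\<in>?P. tv_norm (param_space p) (\<nu> p)) \<le>
      (\<Sum>S\<in>Pow {1..d} - {{}}. tv_norm (borel_vecs S) (\<mu> S))"
  proof -
    have "(\<Sum>p\<in>?P. tv_norm (param_space p) (\<nu> p)) = (\<Sum>S\<in>X. tv_norm (param_space (q S)) (\<nu> (q S)))"
      by (rule sum_q) (simp add: q_out tv_norm_zero)
    also have "\<dots> \<le> (\<Sum>S\<in>X. tv_norm (borel_vecs S) (\<mu> S))"
      unfolding \<nu>q by (intro sum_mono tv_norm_push_le \<mu> push)
    also have "\<dots> \<le> (\<Sum>S\<in>Pow {1..d} - {{}}. tv_norm (borel_vecs S) (\<mu> S))"
      unfolding X_def by (intro sum_mono2) auto
    finally show ?thesis .
  qed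
  ultimately show thesis using that by blast
qed

section \<open>The two inequalities and their extremal functions\<close>

definition variation_bound :: "nat \<Rightarrow> nat \<Rightarrow> nat" where
  "variation_bound d s = min (2 ^ s - 1) (2 ^ d)"

lemma real_variation_bound: "real (variation_bound d s) = min (2 ^ s - 1) (2 ^ d)"
proof -
  have "real (2 ^ s - 1) = 2 ^ s - 1" by (subst of_nat_diff) auto
  then show ?thesis unfolding variation_bound_def of_nat_min by simp
qed

lemma variation_bound_pos: "s \<ge> 1 \<Longrightarrow> variation_bound d s > 0"
  using power_increasing[of 1 s "2::nat"] by (simp add: variation_bound_def)

lemma inverse_bound_mult:
  assumes "s \<ge> 1"
  shows "ennreal (1 / min (2 ^ s - 1) (2 ^ d)) * (of_nat (variation_bound d s) * x) = x"
proof -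
  have "ennreal (1 / real (variation_bound d s)) * ennreal (real (variation_bound d s)) = 1"
    using variation_bound_pos[OF assms, of d] by (simp add: ennreal_mult[symmetric])
  then show ?thesis
    unfolding real_variation_bound[symmetric] ennreal_of_nat_eq_real_of_nat mult.assoc[symmetric] by simp
qed

lemma HK_le_V_XGB:
  assumes "s \<ge> 1"
  shows "ennreal (1 / min (2 ^ s - 1) (2 ^ d)) * (SUP a\<in>anchors d. HK d a f) \<le> V_XGB d s f"
  unfolding V_XGB_def
proof (rule INF_greatest, clarsimp)
  fix c \<nu> assume rep: "represents d s c \<nu> f"
  let ?t = "\<Sum>p\<in>index_pairs d s. tv_norm (param_space p) (\<nu> p)"
  have "HK d a f \<le> of_nat (variation_bound d s) * ?t" for a
  proof -
    obtain c' \<mu> where \<mu>: "canonical_rep d a c' \<mu> f"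
      "(\<Sum>S\<in>Pow {1..d} - {{}}. tv_norm (borel_vecs S) (\<mu> S)) \<le> of_nat (min (2 ^ s - 1) (2 ^ d)) * ?t"
      by (rule canonical_rep_of_represents[OF rep])
    then show ?thesis by (simp add: HK_canonical variation_bound_def)
  qed
  then have "(SUP a\<in>anchors d. HK d a f) \<le> of_nat (variation_bound d s) * ?t" by (intro SUP_least)
  then have "ennreal (1 / min (2 ^ s - 1) (2 ^ d)) * (SUP a\<in>anchors d. HK d a f) \<le>
      ennreal (1 / min (2 ^ s - 1) (2 ^ d)) * (of_nat (variation_bound d s) * ?t)"
    by (rule mult_left_mono) simp
  then show "ennreal (1 / min (2 ^ s - 1) (2 ^ d)) * (SUP a\<in>anchors d. HK d a f) \<le> ?t"
    by (simp only: inverse_bound_mult[OF assms])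
qed

lemma V_XGB_le_HK:
  assumes "f \<in> F_ST d s"
  shows "V_XGB d s f \<le> HK d a f"
proof -
  obtain c \<nu> where "represents d s c \<nu> f" using assms by (auto simp: F_ST_def)
  then obtain c' \<mu> where \<mu>: "canonical_rep d a c' \<mu> f" "\<And>S B. card S > s \<Longrightarrow> \<mu> S B = 0"
    using canonical_rep_of_represents[of d s c \<nu> f a] by metis
  obtain \<nu>' where \<nu>': "represents d s c' \<nu>' f"
    "(\<Sum>p\<in>index_pairs d s. tv_norm (param_space p) (\<nu>' p)) \<le>
      (\<Sum>S\<in>Pow {1..d} - {{}}. tv_norm (borel_vecs S) (\<mu> S))"
    by (rule represents_of_canonical_rep[OF \<mu>])
  have "V_XGB d s f \<le> (\<Sum>p\<in>index_pairs d s. tv_norm (param_space p) (\<nu>' p))"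
    unfolding V_XGB_def using \<nu>'(1) by (intro INF_lower2[of "(c', \<nu>')"]) auto
  then show ?thesis using \<nu>'(2) by (simp add: HK_canonical[OF \<mu>(1)])
qed

section \<open>Extremal functions\<close>

text \<open>The representing family is a single Dirac mass at \<open>(l, u)\<close>.\<close>

lemma basis_fun_in_F_ST:
  assumes LU: "(L, U) \<in> index_pairs d s" and lu: "l \<in> vecs L" "u \<in> vecs U"
  shows "basis_fun L U l u \<in> F_ST d s" "V_XGB d s (basis_fun L U l u) \<le> 1"
proof -
  let ?P = "index_pairs d s"
  define \<nu> where "\<nu> p B = (if p = (L, U) then indicator B (l, u) else 0 :: real)" for p B
  have \<nu>: "\<nu> (L, U) = (\<lambda>B. indicator B (l, u))" "p \<noteq> (L, U) \<Longrightarrow> \<nu> p = (\<lambda>B. 0)" for p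
    by (auto simp: \<nu>_def)
  have sm: "\<forall>p\<in>?P. signed_measure (param_space p) (\<nu> p)"
    using \<nu> by (metis signed_measure_dirac signed_measure_zero)
  note fin = index_pairsD[OF LU]
  have rep: "represents d s 0 \<nu> (basis_fun L U l u)"
    unfolding represents_def
  proof (intro conjI sm ballI)
    fix x
    have "st_fun d s 0 \<nu> x = (\<Sum>p\<in>?P. if p = (L, U) then indicator (basis_set L U x) (l, u) else 0)"
      unfolding st_fun_eq[OF sm] by (auto simp: \<nu>_def intro!: sum.cong)
    also have "\<dots> = basis_fun L U l u x"
      using LU finite_index_pairs by (simp add: basis_fun_eq_indicator[OF fin(3,4) lu])
    finally show "st_fun d s 0 \<nu> x = basis_fun L U l u x" .
  qed
  then show "basis_fun L U l u \<in> F_ST d s" by (auto simp: F_ST_def)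
  have "V_XGB d s (basis_fun L U l u) \<le> (\<Sum>p\<in>?P. tv_norm (param_space p) (\<nu> p))"
    unfolding V_XGB_def using rep by (intro INF_lower2[of "(0, \<nu>)"]) auto
  also have "\<dots> = (\<Sum>p\<in>?P. if p = (L, U) then tv_norm (param_space (L, U)) (\<nu> (L, U)) else 0)"
    using \<nu>(2) by (intro sum.cong refl) (auto simp: tv_norm_zero)
  also have "\<dots> = tv_norm (param_space (L, U)) (\<nu> (L, U))"
    using LU finite_index_pairs by simp
  also have "\<dots> \<le> 1" unfolding \<nu>(1) by (rule tv_norm_dirac_le)
  finally show "V_XGB d s (basis_fun L U l u) \<le> 1" .
qed

text \<open>In any representation, moving from \<open>y\<close> to \<open>x\<close> changes the term
  of an index by the difference of its measure on two sets, which is at most one norm. This supplies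
  the lower bound for the single threshold.\<close>

lemma V_XGB_ge_diff:
  assumes "x \<in> vecs {1..d}" "y \<in> vecs {1..d}"
  shows "ennreal (f x - f y) \<le> V_XGB d s f"
  unfolding V_XGB_def
proof (rule INF_greatest, clarsimp)
  let ?P = "index_pairs d s"
  fix c \<nu> assume rep: "represents d s c \<nu> f"
  then have sm: "\<forall>p\<in>?P. signed_measure (param_space p) (\<nu> p)" by (simp add: represents_def)
  let ?b = "\<lambda>p x. \<nu> p (basis_set (fst p) (snd p) x)"
  have "f z = c + (\<Sum>p\<in>?P. ?b p z)" if "z \<in> vecs {1..d}" for z
    using rep that unfolding st_fun_eq[OF sm, symmetric] by (simp add: represents_def)
  then have "f x - f y = (\<Sum>p\<in>?P. ?b p x - ?b p y)"
    using assms by (simp add: sum_subtractf)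
  also have "\<dots> \<le> (\<Sum>p\<in>?P. max 0 (?b p x - ?b p y))" by (intro sum_mono) auto
  finally have "ennreal (f x - f y) \<le> ennreal (\<Sum>p\<in>?P. max 0 (?b p x - ?b p y))"
    by (rule ennreal_leI)
  also have "\<dots> = (\<Sum>p\<in>?P. ennreal (?b p x - ?b p y))"
    by (subst sum_ennreal[symmetric]) (auto simp: ennreal_max_0)
  also have "\<dots> \<le> (\<Sum>p\<in>?P. tv_norm (param_space p) (\<nu> p))"
  proof (intro sum_mono tv_norm_ge_diff)
    fix p assume p: "p \<in> ?P"
    show "signed_measure (param_space p) (\<nu> p)" using sm p by blast
    have b: "basis_set (fst p) (snd p) z \<in> sets (param_space p)" for z
      using basis_set_sets[of "fst p" "snd p" z] index_pairsD[of "fst p" "snd p" d s] p by simp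
    show "basis_set (fst p) (snd p) x \<in> sets (param_space p)" by (rule b)
    show "basis_set (fst p) (snd p) y \<in> sets (param_space p)" by (rule b)
  qed
  finally show "ennreal (f x - f y) \<le> (\<Sum>p\<in>?P. tv_norm (param_space p) (\<nu> p))" .
qed

lemma basis_fun_not_constant:
  assumes "(L, U) \<in> index_pairs d s" "1 \<in> L" "x \<in> vecs {1..d}" "basis_fun L U l u x = 1"
  shows "\<not> basis_fun L U l u constant_on vecs {1..d}"
proof
  assume "basis_fun L U l u constant_on vecs {1..d}"
  then obtain k where k: "\<And>z. z \<in> vecs {1..d} \<Longrightarrow> basis_fun L U l u z = k"
    by (auto simp: constant_on_def)
  note fin = index_pairsD[OF assms(1)]
  define y where "y = (\<lambda>j\<in>{1..d}. l j - 1)"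
  have "\<exists>j\<in>L. (of_bool (l j \<le> y j) :: real) = 0"
    using fin(1) assms(2) by (intro bexI[of _ 1]) (auto simp: y_def)
  then have "(\<Prod>j\<in>L. of_bool (l j \<le> y j) :: real) = 0" by (intro prod_zero fin)
  then have "basis_fun L U l u y = 0" by (simp add: basis_fun_def)
  moreover have "y \<in> vecs {1..d}" by (simp add: y_def)
  ultimately show False using k[of y] k[OF assms(3)] assms(4) by simp
qed

text \<open>At the anchor -infinity, 1(x_1 >= 0) is already an anchored indicator, so its only
  component is a unit mass at 0 for \<open>S = {1}\<close>.\<close>

lemma HK_single_threshold_le:
  assumes "d \<ge> 1"
  shows "HK d (\<lambda>j\<in>{1..d}. - \<infinity>) (basis_fun {1} {} (\<lambda>j\<in>{1}. 0) u) \<le> 1"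
proof -
  let ?a = "\<lambda>j\<in>{1..d}. - \<infinity> :: ereal" and ?w = "\<lambda>j\<in>{1::nat}. 0::real"
  define \<mu> where "\<mu> S B = (if S = {1} then indicator B ?w else 0 :: real)" for S :: "nat set" and B
  have \<mu>1: "\<mu> {1} = (\<lambda>B. indicator B ?w)" "S \<noteq> {1} \<Longrightarrow> \<mu> S = (\<lambda>B. 0)" for S by (auto simp: \<mu>_def)
  have d1: "{1} \<in> Pow {1..d} - {{}}" using assms by auto
  have "canonical_rep d ?a 0 \<mu> (basis_fun {1} {} ?w u)"
    unfolding canonical_rep_def
  proof (intro conjI allI impI ballI)
    show "signed_measure (borel_vecs S) (\<mu> S)" for S
      using \<mu>1 by (metis signed_measure_dirac signed_measure_zero)
    fix x
    have "(\<Sum>S\<in>Pow {1..d} - {{}}. \<mu> S (orthant ?a S x)) =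
        (\<Sum>S\<in>Pow {1..d} - {{}}. if S = {1} then indicator (orthant ?a {1} x) ?w else 0)"
      by (intro sum.cong refl) (auto simp: \<mu>_def)
    also have "\<dots> = indicator (orthant ?a {1} x) ?w" using d1 by (subst sum.delta) auto
    also have "\<dots> = basis_fun {1} {} ?w u x"
      using assms by (auto simp: basis_fun_def indicator_def mem_orthant)
    finally show "basis_fun {1} {} ?w u x = 0 + (\<Sum>S\<in>Pow {1..d} - {{}}. \<mu> S (orthant ?a S x))" by simp
  qed
  then have "HK d ?a (basis_fun {1} {} ?w u) = (\<Sum>S\<in>Pow {1..d} - {{}}. tv_norm (borel_vecs S) (\<mu> S))"
    by (rule HK_canonical)
  also have "\<dots> = (\<Sum>S\<in>Pow {1..d} - {{}}. if S = {1} then tv_norm (borel_vecs {1}) (\<mu> {1}) else 0)"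
    using \<mu>1(2) by (intro sum.cong refl) (auto simp: tv_norm_zero)
  also have "\<dots> = tv_norm (borel_vecs {1}) (\<mu> {1})" using d1 by (subst sum.delta) auto
  also have "\<dots> \<le> 1" unfolding \<mu>1(1) by (rule tv_norm_dirac_le)
  finally show ?thesis .
qed

text \<open>At the anchor +infinity, the product of the factors 1 - 1(x_j < 0) expands over all
  subsets of \<open>{1..s}\<close>, and each nonempty one carries a mass 1 or -1 at the
  origin.\<close>

lemma HK_lower_orthant_ge:
  assumes "s \<le> d"
  shows "of_nat (2 ^ s - 1) \<le> HK d (\<lambda>j\<in>{1..d}. \<infinity>) (basis_fun {1..s} {} (\<lambda>j\<in>{1..s}. 0) u)"
proof -
  let ?a = "\<lambda>j\<in>{1..d}. \<infinity> :: ereal" and ?w = "\<lambda>S. \<lambda>j\<in>S. 0 :: real"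
  define \<mu> where "\<mu> S B = (if S \<subseteq> {1..s} then (- 1) ^ card S * indicator B (?w S) else 0 :: real)"
    for S :: "nat set" and B
  have \<mu>: "signed_measure (borel_vecs S) (\<mu> S)" for S
    unfolding \<mu>_def[abs_def]
    by (cases "S \<subseteq> {1..s}") (auto intro: signed_measure_cmult signed_measure_dirac signed_measure_zero)
  have "canonical_rep d ?a 1 \<mu> (basis_fun {1..s} {} (?w {1..s}) u)"
    unfolding canonical_rep_def
  proof (intro conjI allI impI ballI \<mu>)
    fix x :: "nat \<Rightarrow> real"
    let ?h = "\<lambda>S. (- 1) ^ card S * (\<Prod>j\<in>S. of_bool (x j < 0)) :: real"
    have "basis_fun {1..s} {} (?w {1..s}) u x = (\<Prod>j\<in>{1..s}. 1 - of_bool (x j < 0))"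
      unfolding basis_fun_def by (auto intro!: prod.cong)
    also have "\<dots> = (\<Sum>S\<in>Pow {1..s}. ?h S)"
      by (subst prod_diff_conv_sum) auto
    also have "\<dots> = ?h {} + (\<Sum>S\<in>Pow {1..s} - {{}}. ?h S)"
      by (rule sum.remove) auto
    also have "?h {} = 1" by simp
    also have "(\<Sum>S\<in>Pow {1..s} - {{}}. ?h S) = (\<Sum>S\<in>Pow {1..d} - {{}}. \<mu> S (orthant ?a S x))"
    proof (rule sum.mono_neutral_cong_left)
      fix S assume S: "S \<in> Pow {1..s} - {{}}"
      have fS: "finite S" using S by (auto intro: finite_subset)
      have "indicator (orthant ?a S x) (?w S) = (\<Prod>j\<in>S. of_bool (x j < 0) :: real)"
        unfolding orthant_def using S assms fS
        by (subst indicator_PiE) (auto simp: indicator_def intro!: prod.cong)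
      then show "?h S = \<mu> S (orthant ?a S x)" using S by (simp add: \<mu>_def)
    qed (use assms in \<open>auto simp: \<mu>_def\<close>)
    finally show "basis_fun {1..s} {} (?w {1..s}) u x = 1 + (\<Sum>S\<in>Pow {1..d} - {{}}. \<mu> S (orthant ?a S x))" .
  qed
  then have HK: "HK d ?a (basis_fun {1..s} {} (?w {1..s}) u) =
      (\<Sum>S\<in>Pow {1..d} - {{}}. tv_norm (borel_vecs S) (\<mu> S))"
    by (rule HK_canonical)
  have one: "1 \<le> tv_norm (borel_vecs S) (\<mu> S)" if S: "S \<in> Pow {1..s} - {{}}" for S
  proof -
    have "vecs S \<in> sets (borel_vecs S)" using sets.top[of "borel_vecs S"] by (simp add: space_PiM)
    \<comment> \<open>Both orders are recorded because the sign of the mass depends on the parity of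
      \<open>card S\<close>.\<close>
    then have "ennreal (\<mu> S (vecs S) - \<mu> S {}) \<le> tv_norm (borel_vecs S) (\<mu> S)"
      "ennreal (\<mu> S {} - \<mu> S (vecs S)) \<le> tv_norm (borel_vecs S) (\<mu> S)"
      by (intro tv_norm_ge_diff \<mu>; simp)+
    moreover have "\<mu> S {} = 0" "\<mu> S (vecs S) = (- 1) ^ card S" using S by (auto simp: \<mu>_def)
    ultimately show ?thesis by (cases "even (card S)") auto
  qed
  have "of_nat (2 ^ s - 1) = (\<Sum>S\<in>Pow {1..s} - {{}}. 1 :: ennreal)"
    by (simp add: card_Pow)
  also have "\<dots> \<le> (\<Sum>S\<in>Pow {1..s} - {{}}. tv_norm (borel_vecs S) (\<mu> S))"
    by (rule sum_mono) (rule one)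
  also have "\<dots> \<le> (\<Sum>S\<in>Pow {1..d} - {{}}. tv_norm (borel_vecs S) (\<mu> S))"
    using assms by (intro sum_mono2) auto
  finally show ?thesis unfolding HK .
qed

text \<open>At +infinity the factor of coordinate 1 is 1(x_1 < 1) - 1(x_1 < 0), without constant
  term. Hence the components are the 2^(d-1) sets containing 1, each with two opposite unit masses
  and so of norm at least 2.\<close>

lemma HK_slab_ge:
  assumes "d \<ge> 1"
  shows "of_nat (2 ^ d) \<le> HK d (\<lambda>j\<in>{1..d}. \<infinity>) (basis_fun {1..d} {1} (\<lambda>j\<in>{1..d}. 0) (\<lambda>j\<in>{1}. 1))"
proof -
  let ?a = "\<lambda>j\<in>{1..d}. \<infinity> :: ereal"
  let ?f = "basis_fun {1..d} {1} (\<lambda>j\<in>{1..d}. 0) (\<lambda>j\<in>{1}. 1)"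
  define w where "w t S = (\<lambda>j\<in>S. if j = 1 then t else 0 :: real)" for t and S :: "nat set"
  define \<mu> where "\<mu> S B = (if 1 \<in> S then (- 1) ^ card (S - {1}) * (indicator B (w 1 S) - indicator B (w 0 S)) else 0 :: real)"
    for S :: "nat set" and B
  have \<mu>: "signed_measure (borel_vecs S) (\<mu> S)" for S
    unfolding \<mu>_def[abs_def]
    by (cases "1 \<in> S") (auto intro!: signed_measure_cmult signed_measure_diff signed_measure_dirac signed_measure_zero)
  let ?T = "insert 1 ` Pow {2..d}"
  have T: "?T \<subseteq> Pow {1..d} - {{}}" using assms by auto
  have inj: "inj_on (insert 1) (Pow {2..d::nat})" 
  proof (rule inj_onI)
    fix S S' assume "S \<in> Pow {2..d::nat}" "S' \<in> Pow {2..d}" "insert 1 S = insert 1 S'"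
    moreover from this have "1 \<notin> S" "1 \<notin> S'" by auto
    ultimately show "S = S'" using insert_ident by metis
  qed
  have out: "1 \<notin> S" if "S \<in> Pow {1..d} - {{}} - ?T" for S
  proof
    assume "1 \<in> S"
    then have "insert 1 (S - {1}) = S" by blast
    moreover have "S - {1} \<in> Pow {2..d}" using that by force
    ultimately have "S \<in> ?T" by (metis image_eqI)
    then show False using that by blast
  qed
  have "canonical_rep d ?a 0 \<mu> ?f"
    unfolding canonical_rep_def
  proof (intro conjI allI impI ballI \<mu>)
    fix x :: "nat \<Rightarrow> real"
    let ?h = "\<lambda>S. (- 1) ^ card S * (\<Prod>j\<in>S. of_bool (x j < 0)) :: real"
    let ?e = "of_bool (x 1 < 1) - of_bool (x 1 < 0) :: real"
    have ins: "{1..d} = insert 1 {2..d}" using assms by auto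
    have "?f x = (of_bool (0 \<le> x 1) * (\<Prod>j\<in>{2..d}. of_bool (0 \<le> x j))) * of_bool (x 1 < 1)"
      unfolding basis_fun_def ins by (simp add: ins[symmetric])
    also have "\<dots> = ?e * (\<Prod>j\<in>{2..d}. 1 - of_bool (x j < 0))"
      by (auto simp: of_bool_def intro!: prod.cong)
    also have "(\<Prod>j\<in>{2..d}. 1 - of_bool (x j < 0) :: real) = (\<Sum>S\<in>Pow {2..d}. ?h S)"
      by (subst prod_diff_conv_sum) auto
    also have "?e * (\<Sum>S\<in>Pow {2..d}. ?h S) = (\<Sum>S\<in>Pow {2..d}. \<mu> (insert 1 S) (orthant ?a (insert 1 S) x))"
      unfolding sum_distrib_left
    proof (rule sum.cong[OF refl])
      fix S assume S: "S \<in> Pow {2..d}"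
      have fS: "finite S" "1 \<notin> S" using S by (auto intro: finite_subset)
      have "indicator (orthant ?a (insert 1 S) x) (w t (insert 1 S)) =
          of_bool (x 1 < t) * (\<Prod>j\<in>S. of_bool (x j < 0) :: real)" for t
      proof -
        have "indicator (orthant ?a (insert 1 S) x) (w t (insert 1 S)) =
            (\<Prod>j\<in>insert 1 S. of_bool (x j < w t (insert 1 S) j) :: real)"
          unfolding orthant_def using S assms fS
          by (subst indicator_PiE) (auto simp: indicator_def w_def intro!: prod.cong)
        also have "\<dots> = of_bool (x 1 < t) * (\<Prod>j\<in>S. of_bool (x j < w t (insert 1 S) j))"
          using fS by (simp add: w_def)
        also have "(\<Prod>j\<in>S. of_bool (x j < w t (insert 1 S) j) :: real) = (\<Prod>j\<in>S. of_bool (x j < 0))"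
          using fS by (intro prod.cong refl) (auto simp: w_def)
        finally show ?thesis .
      qed
      then show "?e * ?h S = \<mu> (insert 1 S) (orthant ?a (insert 1 S) x)"
        using fS by (simp add: \<mu>_def algebra_simps)
    qed
    also have "\<dots> = (\<Sum>S\<in>?T. \<mu> S (orthant ?a S x))"
      unfolding sum.reindex[OF inj] o_def ..
    also have "\<dots> = (\<Sum>S\<in>Pow {1..d} - {{}}. \<mu> S (orthant ?a S x))"
      using T out by (intro sum.mono_neutral_left) (auto simp: \<mu>_def)
    finally show "?f x = 0 + (\<Sum>S\<in>Pow {1..d} - {{}}. \<mu> S (orthant ?a S x))" unfolding add_0_left .
  qed
  then have HK: "HK d ?a ?f = (\<Sum>S\<in>Pow {1..d} - {{}}. tv_norm (borel_vecs S) (\<mu> S))"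
    by (rule HK_canonical)
  have two: "2 \<le> tv_norm (borel_vecs S) (\<mu> S)" if S: "1 \<in> S" for S
  proof -
    \<comment> \<open>The level 1/2 separates the mass at first coordinate 1 from the one at
      0.\<close>
    define A where "A = {v \<in> vecs S. v 1 > 1 / 2}"
    define A' where "A' = {v \<in> vecs S. \<not> v 1 > 1 / 2}"
    have "{v \<in> space (borel_vecs S). v 1 > 1 / 2} \<in> sets (borel_vecs S)"
      "{v \<in> space (borel_vecs S). \<not> v 1 > 1 / 2} \<in> sets (borel_vecs S)"
      using S by measurable
    then have "A \<in> sets (borel_vecs S)" "A' \<in> sets (borel_vecs S)"
      by (simp_all add: space_borel_vecs A_def A'_def)
    then have "ennreal (\<mu> S A - \<mu> S A') \<le> tv_norm (borel_vecs S) (\<mu> S)"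
      "ennreal (\<mu> S A' - \<mu> S A) \<le> tv_norm (borel_vecs S) (\<mu> S)"
      by (intro tv_norm_ge_diff \<mu>; simp)+
    moreover have "\<mu> S A = (- 1) ^ card (S - {1})" "\<mu> S A' = - ((- 1) ^ card (S - {1}))"
      using S by (auto simp: \<mu>_def A_def A'_def w_def indicator_def)
    ultimately show ?thesis by (cases "even (card (S - {1}))") auto
  qed
  have "card ?T = 2 ^ (d - 1)" unfolding card_image[OF inj] by (simp add: card_Pow)
  then have "(of_nat (2 ^ d) :: ennreal) = (\<Sum>S\<in>?T. 2)"
    using assms by (cases d) (auto simp: mult.commute)
  also have "\<dots> \<le> (\<Sum>S\<in>?T. tv_norm (borel_vecs S) (\<mu> S))"
    by (rule sum_mono) (auto intro: two)
  also have "\<dots> \<le> (\<Sum>S\<in>Pow {1..d} - {{}}. tv_norm (borel_vecs S) (\<mu> S))"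
    using T by (intro sum_mono2) auto
  finally show ?thesis unfolding HK .
qed

text \<open>As \<open>V_XGB\<close> of a basis function is at most 1, a single anchor at which HK
  reaches the bound forces equality.\<close>

lemma left_equality:
  assumes s: "s \<ge> 1" and LU: "(L, U) \<in> index_pairs d s" "l \<in> vecs L" "u \<in> vecs U"
    and a: "a \<in> anchors d"
    and ge: "of_nat (variation_bound d s) \<le> HK d a (basis_fun L U l u)"
  shows "ennreal (1 / min (2 ^ s - 1) (2 ^ d)) * (SUP a\<in>anchors d. HK d a (basis_fun L U l u)) =
    V_XGB d s (basis_fun L U l u)"
proof (rule antisym[OF HK_le_V_XGB[OF s]])
  have "V_XGB d s (basis_fun L U l u) \<le> 1" by (rule basis_fun_in_F_ST[OF LU])
  also have "1 = ennreal (1 / min (2 ^ s - 1) (2 ^ d)) * (of_nat (variation_bound d s) * 1)"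
    by (rule inverse_bound_mult[OF s, symmetric])
  also have "\<dots> \<le> ennreal (1 / min (2 ^ s - 1) (2 ^ d)) * (SUP a\<in>anchors d. HK d a (basis_fun L U l u))"
    using ge by (intro mult_left_mono) (auto intro: SUP_upper2[OF a])
  finally show "V_XGB d s (basis_fun L U l u) \<le>
      ennreal (1 / min (2 ^ s - 1) (2 ^ d)) * (SUP a\<in>anchors d. HK d a (basis_fun L U l u))" .
qed

theorem proposition5:
  fixes d s :: nat
  assumes "d \<ge> 1" and "s \<ge> 1"
  shows "(\<forall>f\<in>F_ST d s.
            ennreal (1 / min (2 ^ s - 1) (2 ^ d)) * (SUP a\<in>anchors d. HK d a f) \<le> V_XGB d s f \<and>
            V_XGB d s f \<le> (INF a\<in>anchors d. HK d a f)) \<and>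
         (\<exists>f\<in>F_ST d s. \<not> f constant_on vecs {1..d} \<and>
            ennreal (1 / min (2 ^ s - 1) (2 ^ d)) * (SUP a\<in>anchors d. HK d a f) = V_XGB d s f) \<and>
         (\<exists>f\<in>F_ST d s. \<not> f constant_on vecs {1..d} \<and>
            V_XGB d s f = (INF a\<in>anchors d. HK d a f))"
proof (intro conjI)
  show "\<forall>f\<in>F_ST d s.
            ennreal (1 / min (2 ^ s - 1) (2 ^ d)) * (SUP a\<in>anchors d. HK d a f) \<le> V_XGB d s f \<and>
            V_XGB d s f \<le> (INF a\<in>anchors d. HK d a f)"
    using HK_le_V_XGB[OF assms(2)] V_XGB_le_HK by (auto intro: INF_greatest)
next
  define x :: "nat \<Rightarrow> real" where "x = (\<lambda>j\<in>{1..d}. 0)"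
  have x: "x \<in> vecs {1..d}" by (simp add: x_def)
  have top: "(\<lambda>j\<in>{1..d}. \<infinity>) \<in> anchors d" by (auto simp: anchors_def)
  show "\<exists>f\<in>F_ST d s. \<not> f constant_on vecs {1..d} \<and>
            ennreal (1 / min (2 ^ s - 1) (2 ^ d)) * (SUP a\<in>anchors d. HK d a f) = V_XGB d s f"
  proof (cases "s \<le> d")
    case True
    \<comment> \<open>\<open>\<lambda>_. undefined\<close> is the only element of
      \<open>vecs {}\<close>, the vector of no upper thresholds.\<close>
    let ?f = "basis_fun {1..s} {} (\<lambda>j\<in>{1..s}. 0) (\<lambda>_. undefined)"
    have LU: "({1..s}, {}) \<in> index_pairs d s" using True assms by (auto simp: index_pairs_def)
    have "of_nat (variation_bound d s) \<le> (of_nat (2 ^ s - 1) :: ennreal)"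
      by (simp only: of_nat_le_iff variation_bound_def min.cobounded1)
    then have "of_nat (variation_bound d s) \<le> HK d (\<lambda>j\<in>{1..d}. \<infinity>) ?f"
      using HK_lower_orthant_ge[OF True] by (rule order_trans)
    then have eq: "ennreal (1 / min (2 ^ s - 1) (2 ^ d)) * (SUP a\<in>anchors d. HK d a ?f) = V_XGB d s ?f"
      using assms(2) LU top by (intro left_equality) auto
    have "\<not> ?f constant_on vecs {1..d}"
      using assms True x by (intro basis_fun_not_constant[OF LU _ x]) (auto simp: basis_fun_def x_def)
    moreover have "?f \<in> F_ST d s" using LU by (intro basis_fun_in_F_ST) auto
    ultimately show ?thesis using eq by blast
  next
    case False
    let ?f = "basis_fun {1..d} {1} (\<lambda>j\<in>{1..d}. 0) (\<lambda>j\<in>{1}. 1)"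
    \<comment> \<open>Admissible because d + 1 <= s in this case.\<close>
    have LU: "({1..d}, {1}) \<in> index_pairs d s" using False assms by (auto simp: index_pairs_def)
    have "of_nat (variation_bound d s) \<le> (of_nat (2 ^ d) :: ennreal)"
      by (simp only: of_nat_le_iff variation_bound_def min.cobounded2)
    then have "of_nat (variation_bound d s) \<le> HK d (\<lambda>j\<in>{1..d}. \<infinity>) ?f"
      using HK_slab_ge[OF assms(1)] by (rule order_trans)
    then have eq: "ennreal (1 / min (2 ^ s - 1) (2 ^ d)) * (SUP a\<in>anchors d. HK d a ?f) = V_XGB d s ?f"
      using assms(2) LU top by (intro left_equality) auto
    have "\<not> ?f constant_on vecs {1..d}"
      using assms x by (intro basis_fun_not_constant[OF LU _ x]) (auto simp: basis_fun_def x_def)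
    moreover have "?f \<in> F_ST d s" using LU by (intro basis_fun_in_F_ST) auto
    ultimately show ?thesis using eq by blast
  qed
next
  let ?f = "basis_fun {1} {} (\<lambda>j\<in>{1}. 0) (\<lambda>_. undefined)"
  define x y :: "nat \<Rightarrow> real" where "x = (\<lambda>j\<in>{1..d}. 0)" and "y = (\<lambda>j\<in>{1..d}. - 1)"
  have xy: "x \<in> vecs {1..d}" "y \<in> vecs {1..d}" by (simp_all add: x_def y_def)
  have LU: "({1}, {}) \<in> index_pairs d s" using assms by (auto simp: index_pairs_def)
  have mem: "?f \<in> F_ST d s" using LU by (intro basis_fun_in_F_ST) auto
  have fx: "?f x = 1" "?f y = 0" using assms by (auto simp: basis_fun_def x_def y_def)
  have "(INF a\<in>anchors d. HK d a ?f) \<le> HK d (\<lambda>j\<in>{1..d}. - \<infinity>) ?f"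
    by (intro INF_lower) (auto simp: anchors_def)
  also have "\<dots> \<le> 1" using assms(1) by (rule HK_single_threshold_le)
  \<comment> \<open>The points \<open>x\<close> and \<open>y\<close> lie on the two sides of the
    threshold, where the function jumps by 1.\<close>
  also have "1 \<le> V_XGB d s ?f" using V_XGB_ge_diff[OF xy, of ?f s, unfolded fx] by simp
  finally have "V_XGB d s ?f = (INF a\<in>anchors d. HK d a ?f)"
    using V_XGB_le_HK[OF mem] by (intro antisym INF_greatest)
  moreover have "\<not> ?f constant_on vecs {1..d}"
    using basis_fun_not_constant[OF LU _ xy(1)] fx by simp
  ultimately show "\<exists>f\<in>F_ST d s. \<not> f constant_on vecs {1..d} \<and>
            V_XGB d s f = (INF a\<in>anchors d. HK d a f)"
    using mem by blast
qed

end
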